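(* Let $m\ge1$ and let $M$ be a $V_m$-module. The one-term Yang-Baxter chain complex $(C_n^{YB},\partial_n^{YB})$ with coefficients in $M$ has a direct sum decomposition into the tensor product $C^f(M)\otimes B(V_m)$, where $C^f(M)=(M\otimes[V]_n,\bar\partial_n^{YB})$ is the subcomplex of $(C_n^{YB},\partial_n^{YB})$ with $\bar\partial_n^{YB}$ the restriction of $\partial_n^{YB}$ to $M\otimes[V]_n$, and $B(V_m)=\bigoplus_{n\ge0}\ker\sigma_n$ is a graded vector space depending only on $V_m$. Explicitly, for every $n\ge0$, $$C_n^{YB}=\bigoplus_{k=0}^{n}M\otimes[V]_k\otimes\ker\sigma_{n-k},$$ and $\partial_n^{YB}$ maps $M\otimes[V]_k\otimes\ker\sigma_{n-k}$ to $M\otimes[V]_{k-1}\otimes\ker\sigma_{n-k}$ by $\bar\partial_k^{YB}\otimes\mathrm{id}$ for $k\ge1$, and is zero on $M\otimes\ker\sigma_n$ (the summand $k=0$).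
   Context: Let $\mathbb{K}=\mathbb{C}(y)$, and let $V=V_m$ be the $\mathbb{K}$-vector space with basis $v_1,\dots,v_m$; tensor products are over $\mathbb{K}$. The Yang-Baxter operator $R=R_m:V\otimes V\to V\otimes V$ is the linear map with $R(v_i\otimes v_j)=(1-y^2)v_i\otimes v_j+y^2v_j\otimes v_i$ and $R(v_j\otimes v_i)=v_i\otimes v_j$ for $1\le i<j\le m$, and $R(v_i\otimes v_i)=v_i\otimes v_i$. A $V_m$-module is a $\mathbb{K}$-vector space $M$ with a linear map $R_M:M\otimes V\to M$ satisfying the wall condition $R_M\circ(R_M\otimes\mathrm{id}_V)=R_M\circ(R_M\otimes\mathrm{id}_V)\circ(\mathrm{id}_M\otimes R)$. For $n\ge1$ let $d_1^n=\mathrm{id}_{V^{\otimes n}}$ and, for $2\le k\le n$, $d_k^n=(R\otimes\mathrm{id}_{V^{\otimes n-2}})\circ(\mathrm{id}_V\otimes R\otimes\mathrm{id}_{V^{\otimes n-3}})\circ\cdots\circ(\mathrm{id}_{V^{\otimes k-2}}\otimes R\otimes\mathrm{id}_{V^{\otimes n-k}})$ (the rightmost map is applied first). Let $\sigma_n=\sum_{k=1}^n(-1)^{k-1}d_k^n:V^{\otimes n}\to V^{\otimes n}$, and put $\ker\sigma_0=\mathbb{K}=V^{\otimes0}$. The one-term Yang-Baxter complex has terms $C_n^{YB}=M\otimes V^{\otimes n}$ ($n\ge0$) and differential $\partial_n^{YB}=\sum_{i=1}^n(-1)^{i-1}d_{i,n}:C_n^{YB}\to C_{n-1}^{YB}$,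 where $d_{i,n}=(R_M\otimes\mathrm{id}_{V^{\otimes n-1}})\circ(\mathrm{id}_M\otimes d_i^n)$; $\partial_0^{YB}=0$. For $n\ge 1$, $[V]_n\subset V^{\otimes n}$ is the span of all elements $[v_{i_1},\dots,v_{i_n}]=\sum_{\tau\in S_n}\mathrm{sgn}(\tau)\,v_{i_{\tau(1)}}\otimes\cdots\otimes v_{i_{\tau(n)}}$, with $\mathrm{sgn}(\tau)\in\{1,-1\}$ the sign of $\tau$; $[V]_0=\mathbb{K}$, and $[V]_n=0$ for $n>m$. *)

theory Defs
  imports
    "HOL-Library.Function_Algebras"
    "HOL-Library.FuncSet"
    "HOL-Combinatorics.Permutations"
    "HOL-Computational_Algebra.Polynomial"
    "HOL-Computational_Algebra.Fraction_Field"
begin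

section \<open>The ground field and linear algebra on subspaces\<close>

type_synonym K = "complex poly fract"

definition yK :: K where
  "yK = Fract [:0, 1:] 1"

text \<open>The scalar multiplication of functions induced by a scalar multiplication of values.\<close>

definition pw :: "(K \<Rightarrow> 'a \<Rightarrow> 'a) \<Rightarrow> K \<Rightarrow> ('i \<Rightarrow> 'a) \<Rightarrow> 'i \<Rightarrow> 'a" where
  "pw scale c f = (\<lambda>i. scale c (f i))"

definition linear_on ::
  "(K \<Rightarrow> 'a \<Rightarrow> 'a) \<Rightarrow> (K \<Rightarrow> 'b \<Rightarrow> 'b) \<Rightarrow> 'a::ab_group_add set \<Rightarrow> ('a \<Rightarrow> 'b::ab_group_add) \<Rightarrow> bool" where
  "linear_on s s' W f \<longleftrightarrow>
     (\<forall>x\<in>W. \<forall>x'\<in>W. f (x + x') = f x + f x') \<and> (\<forall>c. \<forall>x\<in>W. f (s c x) = s' c (f x))"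

text \<open>\<open>W\<close> is the internal direct sum of its subspaces \<open>U k\<close>, for \<open>k\<close> in the finite set \<open>I\<close>.\<close>

definition internal_direct_sum ::
  "(K \<Rightarrow> 'a \<Rightarrow> 'a) \<Rightarrow> 'a::ab_group_add set \<Rightarrow> 'i set \<Rightarrow> ('i \<Rightarrow> 'a set) \<Rightarrow> bool" where
  "internal_direct_sum s W I U \<longleftrightarrow>
     (\<forall>k\<in>I. module.subspace s (U k) \<and> U k \<subseteq> W) \<and>
     (\<forall>x\<in>W. \<exists>!g. g \<in> (\<Pi>\<^sub>E k\<in>I. U k) \<and> x = (\<Sum>k\<in>I. g k))"

text \<open>Complexes are graded by the natural numbers and live inside one ambient vector space;
  \<open>d n\<close> maps degree \<open>n\<close> to degree \<open>n - 1\<close>, and \<open>d 0\<close> is zero.\<close>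

definition chain_complex ::
  "(K \<Rightarrow> 'a \<Rightarrow> 'a) \<Rightarrow> (nat \<Rightarrow> 'a::ab_group_add set) \<Rightarrow> (nat \<Rightarrow> 'a \<Rightarrow> 'a) \<Rightarrow> bool" where
  "chain_complex s C d \<longleftrightarrow>
     (\<forall>n. module.subspace s (C n) \<and> linear_on s s (C n) (d n)) \<and>
     (\<forall>n. \<forall>x\<in>C (Suc n). d (Suc n) x \<in> C n) \<and>
     (\<forall>x\<in>C 0. d 0 x = 0) \<and>
     (\<forall>n. \<forall>x\<in>C (Suc n). d n (d (Suc n) x) = 0)"

definition subcomplex ::
  "(K \<Rightarrow> 'a \<Rightarrow> 'a) \<Rightarrow> (nat \<Rightarrow> 'a::ab_group_add set) \<Rightarrow> (nat \<Rightarrow> 'a \<Rightarrow> 'a) \<Rightarrow>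
   (nat \<Rightarrow> 'a set) \<Rightarrow> (nat \<Rightarrow> 'a \<Rightarrow> 'a) \<Rightarrow> bool" where
  "subcomplex s C' d' C d \<longleftrightarrow>
     chain_complex s C' d' \<and> (\<forall>n. C' n \<subseteq> C n) \<and> (\<forall>n. \<forall>x\<in>C' n. d' n x = d n x)"

section \<open>Tensor products in coordinates\<close>

text \<open>The space \<open>V\<close> has the basis \<open>v 1, ..., v m\<close>, so \<open>M \<otimes> V\<^sup>\<otimes>\<^sup>n\<close> is represented by the
  functions from words of length \<open>n\<close> over \<open>{1..m}\<close> to \<open>M\<close>, extended by zero to all lists:
  the function \<open>f\<close> stands for the sum of \<open>f [i1, ..., in] \<otimes> v i1 \<otimes> ... \<otimes> v in\<close> over all such
  words. Here \<open>M\<close> is a type with a scalar multiplication \<open>scale\<close>. The case \<open>M = K\<close>, with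
  multiplication as \<open>scale\<close>, gives \<open>V\<^sup>\<otimes>\<^sup>n\<close>; functions supported on the empty word represent
  \<open>M \<otimes> V\<^sup>\<otimes>\<^sup>0 = M\<close>.\<close>

definition words :: "nat \<Rightarrow> nat \<Rightarrow> nat list set" where
  "words m n = {w. length w = n \<and> set w \<subseteq> {1..m}}"

definition tensor_space :: "nat \<Rightarrow> nat \<Rightarrow> (nat list \<Rightarrow> 'a::zero) set" where
  "tensor_space m n = {f. \<forall>w. w \<notin> words m n \<longrightarrow> f w = 0}"

definition basis_tensor :: "nat list \<Rightarrow> nat list \<Rightarrow> K" where
  "basis_tensor w = (\<lambda>u. if u = w then 1 else 0)"

text \<open>The elementary tensor of \<open>x\<close> in \<open>M\<close> and \<open>b\<close> in \<open>V\<^sup>\<otimes>\<^sup>n\<close>.\<close>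

definition pure_tensor :: "(K \<Rightarrow> 'a \<Rightarrow> 'a) \<Rightarrow> 'a \<Rightarrow> (nat list \<Rightarrow> K) \<Rightarrow> nat list \<Rightarrow> 'a" where
  "pure_tensor scale x b = (\<lambda>w. scale (b w) x)"

text \<open>The tensor of \<open>f\<close> in \<open>M \<otimes> V\<^sup>\<otimes>\<^sup>p\<close> and \<open>b\<close> in \<open>V\<^sup>\<otimes>\<^sup>q\<close>, an element of \<open>M \<otimes> V\<^sup>\<otimes>\<^sup>(\<^sup>p\<^sup>+\<^sup>q\<^sup>)\<close>.\<close>

definition tensor ::
  "(K \<Rightarrow> 'a \<Rightarrow> 'a) \<Rightarrow> nat \<Rightarrow> (nat list \<Rightarrow> 'a) \<Rightarrow> (nat list \<Rightarrow> K) \<Rightarrow> nat list \<Rightarrow> 'a" where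
  "tensor scale p f b = (\<lambda>w. scale (b (drop p w)) (f (take p w)))"

text \<open>For a subspace \<open>B\<close> of \<open>V\<^sup>\<otimes>\<^sup>n\<close> this is \<open>M \<otimes> B\<close>, as a subspace of \<open>M \<otimes> V\<^sup>\<otimes>\<^sup>n\<close>.\<close>

definition coeff_tensor_sub ::
  "(K \<Rightarrow> 'a \<Rightarrow> 'a) \<Rightarrow> (nat list \<Rightarrow> K) set \<Rightarrow> (nat list \<Rightarrow> 'a::ab_group_add) set" where
  "coeff_tensor_sub scale B = module.span (pw scale) {pure_tensor scale x b | x b. b \<in> B}"

text \<open>For subspaces \<open>X\<close> of \<open>M \<otimes> V\<^sup>\<otimes>\<^sup>p\<close> and \<open>B\<close> of \<open>V\<^sup>\<otimes>\<^sup>q\<close> this is \<open>X \<otimes> B\<close>, as a subspace of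
  \<open>M \<otimes> V\<^sup>\<otimes>\<^sup>(\<^sup>p\<^sup>+\<^sup>q\<^sup>)\<close>.\<close>

definition tensor_sub ::
  "(K \<Rightarrow> 'a \<Rightarrow> 'a) \<Rightarrow> nat \<Rightarrow> (nat list \<Rightarrow> 'a::ab_group_add) set \<Rightarrow> (nat list \<Rightarrow> K) set \<Rightarrow>
   (nat list \<Rightarrow> 'a) set" where
  "tensor_sub scale p X B = module.span (pw scale) {tensor scale p f b | f b. f \<in> X \<and> b \<in> B}"

section \<open>Tensor products of linear maps with identity maps\<close>

text \<open>For \<open>f\<close> in \<open>M \<otimes> V\<^sup>\<otimes>\<^sup>(\<^sup>p\<^sup>+\<^sup>r\<^sup>)\<close> and a word \<open>z\<close> of length \<open>r\<close>, the element of \<open>M \<otimes> V\<^sup>\<otimes>\<^sup>p\<close> that is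
  the coefficient of the basis tensor \<open>z\<close> of the last \<open>r\<close> factors.\<close>

definition slice :: "nat \<Rightarrow> nat list \<Rightarrow> (nat list \<Rightarrow> 'a::zero) \<Rightarrow> nat list \<Rightarrow> 'a" where
  "slice p z f = (\<lambda>u. if length u = p then f (u @ z) else 0)"

text \<open>\<open>F \<otimes> id\<close> on \<open>M \<otimes> V\<^sup>\<otimes>\<^sup>(\<^sup>p\<^sup>+\<^sup>r\<^sup>)\<close>, for \<open>F\<close> from (a subspace of) \<open>M \<otimes> V\<^sup>\<otimes>\<^sup>p\<close> to \<open>N \<otimes> V\<^sup>\<otimes>\<^sup>q\<close>;
  the formula does not depend on \<open>r\<close>. If \<open>F\<close> is defined on a subspace \<open>X\<close> only, this is meant on
  \<open>X \<otimes> B\<close>, all of whose slices are in \<open>X\<close>.\<close>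

definition map_tensor_id ::
  "nat \<Rightarrow> nat \<Rightarrow> ((nat list \<Rightarrow> 'a::zero) \<Rightarrow> nat list \<Rightarrow> 'b) \<Rightarrow> (nat list \<Rightarrow> 'a) \<Rightarrow> nat list \<Rightarrow> 'b" where
  "map_tensor_id p q F f = (\<lambda>w. F (slice p (drop q w) f) (take q w))"

text \<open>\<open>F \<otimes> id\<close> from \<open>M \<otimes> V \<otimes> V\<^sup>\<otimes>\<^sup>r\<close> to \<open>M \<otimes> V\<^sup>\<otimes>\<^sup>r\<close>, for \<open>F\<close> from \<open>M \<otimes> V\<close> to \<open>M\<close>.\<close>

definition act_tensor_id ::
  "((nat list \<Rightarrow> 'a::zero) \<Rightarrow> 'a) \<Rightarrow> (nat list \<Rightarrow> 'a) \<Rightarrow> nat list \<Rightarrow> 'a" where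
  "act_tensor_id F f = (\<lambda>w. F (slice 1 w f))"

text \<open>The map \<open>id \<otimes> F \<otimes> id\<close> on \<open>V\<^sup>\<otimes>\<^sup>j \<otimes> V\<^sup>\<otimes>\<^sup>p \<otimes> V\<^sup>\<otimes>\<^sup>r\<close>, for an endomorphism \<open>F\<close> of \<open>V\<^sup>\<otimes>\<^sup>p\<close>; the
  formula does not depend on \<open>r\<close>.\<close>

definition id_map_id ::
  "nat \<Rightarrow> nat \<Rightarrow> ((nat list \<Rightarrow> K) \<Rightarrow> nat list \<Rightarrow> K) \<Rightarrow> (nat list \<Rightarrow> K) \<Rightarrow> nat list \<Rightarrow> K" where
  "id_map_id j p F f =
     (\<lambda>w. F (\<lambda>u. if length u = p then f (take j w @ u @ drop (j + p) w) else 0) (take p (drop j w)))"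

text \<open>\<open>id \<otimes> G\<close> on \<open>M \<otimes> V\<^sup>\<otimes>\<^sup>n\<close>, where \<open>G\<close> is given by its values on basis tensors.\<close>

definition id_tensor_basis ::
  "(K \<Rightarrow> 'a \<Rightarrow> 'a) \<Rightarrow> nat \<Rightarrow> nat \<Rightarrow> (nat list \<Rightarrow> nat list \<Rightarrow> K) \<Rightarrow>
   (nat list \<Rightarrow> 'a::ab_group_add) \<Rightarrow> nat list \<Rightarrow> 'a" where
  "id_tensor_basis scale m n G f = (\<lambda>w. \<Sum>u\<in>words m n. scale (G u w) (f u))"

text \<open>\<open>id \<otimes> F\<close> on \<open>M \<otimes> V\<^sup>\<otimes>\<^sup>n\<close>, for a linear map \<open>F\<close> on \<open>V\<^sup>\<otimes>\<^sup>n\<close>.\<close>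

definition id_tensor_map ::
  "(K \<Rightarrow> 'a \<Rightarrow> 'a) \<Rightarrow> nat \<Rightarrow> nat \<Rightarrow> ((nat list \<Rightarrow> K) \<Rightarrow> nat list \<Rightarrow> K) \<Rightarrow>
   (nat list \<Rightarrow> 'a::ab_group_add) \<Rightarrow> nat list \<Rightarrow> 'a" where
  "id_tensor_map scale m n F = id_tensor_basis scale m n (\<lambda>u. F (basis_tensor u))"

section \<open>The Yang-Baxter operator and modules over it\<close>

definition R_basis :: "nat list \<Rightarrow> nat list \<Rightarrow> K" where
  "R_basis u =
     (let i = u ! 0; j = u ! 1 in
      if i < j then (\<lambda>w. (1 - yK\<^sup>2) * basis_tensor [i, j] w + yK\<^sup>2 * basis_tensor [j, i] w)
      else basis_tensor [j, i])"

definition R_op :: "nat \<Rightarrow> (nat list \<Rightarrow> K) \<Rightarrow> nat list \<Rightarrow> K" where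
  "R_op m = id_tensor_basis (*) m 2 R_basis"

definition V_module ::
  "nat \<Rightarrow> (K \<Rightarrow> 'a::ab_group_add \<Rightarrow> 'a) \<Rightarrow> ((nat list \<Rightarrow> 'a) \<Rightarrow> 'a) \<Rightarrow> bool" where
  "V_module m scale RM \<longleftrightarrow>
     vector_space scale \<and>
     linear_on (pw scale) scale (tensor_space m 1) RM \<and>
     (\<forall>f\<in>tensor_space m 2.
        RM (act_tensor_id RM f) = RM (act_tensor_id RM (id_tensor_map scale m 2 (R_op m) f)))"

section \<open>The one-term Yang-Baxter complex\<close>

text \<open>The map \<open>d\<^sub>k\<^sup>n\<close>, by one formula for all \<open>n \<ge> k\<close>: the composition of the maps
  \<open>id \<otimes> R \<otimes> id\<close> with \<open>j = 0, ..., k - 2\<close> factors to the left of \<open>R\<close>, where \<open>j = k - 2\<close> is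
  applied first.\<close>

definition d_op :: "nat \<Rightarrow> nat \<Rightarrow> (nat list \<Rightarrow> K) \<Rightarrow> nat list \<Rightarrow> K" where
  "d_op m k = foldr (\<circ>) (map (\<lambda>j. id_map_id j 2 (R_op m)) [0..<k - 1]) id"

definition sigma :: "nat \<Rightarrow> nat \<Rightarrow> (nat list \<Rightarrow> K) \<Rightarrow> nat list \<Rightarrow> K" where
  "sigma m n f = (\<lambda>w. \<Sum>k = 1..n. (-1) ^ (k - 1) * d_op m k f w)"

text \<open>For \<open>n = 0\<close> the sum is empty, so that \<open>ker_sigma m 0\<close> is all of \<open>V\<^sup>\<otimes>\<^sup>0 = K\<close>.\<close>

definition ker_sigma :: "nat \<Rightarrow> nat \<Rightarrow> (nat list \<Rightarrow> K) set" where
  "ker_sigma m n = {f \<in> tensor_space m n. sigma m n f = 0}"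

definition face ::
  "nat \<Rightarrow> (K \<Rightarrow> 'a::ab_group_add \<Rightarrow> 'a) \<Rightarrow> ((nat list \<Rightarrow> 'a) \<Rightarrow> 'a) \<Rightarrow> nat \<Rightarrow> nat \<Rightarrow>
   (nat list \<Rightarrow> 'a) \<Rightarrow> nat list \<Rightarrow> 'a" where
  "face m scale RM i n f = act_tensor_id RM (id_tensor_map scale m n (d_op m i) f)"

definition YB_diff ::
  "nat \<Rightarrow> (K \<Rightarrow> 'a::ab_group_add \<Rightarrow> 'a) \<Rightarrow> ((nat list \<Rightarrow> 'a) \<Rightarrow> 'a) \<Rightarrow> nat \<Rightarrow>
   (nat list \<Rightarrow> 'a) \<Rightarrow> nat list \<Rightarrow> 'a" where
  "YB_diff m scale RM n f = (\<Sum>i = 1..n. pw scale ((-1) ^ (i - 1)) (face m scale RM i n f))"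

section \<open>The antisymmetric tensors\<close>

definition bracket :: "nat list \<Rightarrow> nat list \<Rightarrow> K" where
  "bracket w =
     (\<Sum>\<tau> | \<tau> permutes {..<length w}. pw (*) (of_int (sign \<tau>)) (basis_tensor (permute_list \<tau> w)))"

definition antisym :: "nat \<Rightarrow> nat \<Rightarrow> (nat list \<Rightarrow> K) set" where
  "antisym m n = module.span (pw (*)) (bracket ` words m n)"

definition Cf :: "nat \<Rightarrow> (K \<Rightarrow> 'a::ab_group_add \<Rightarrow> 'a) \<Rightarrow> nat \<Rightarrow> (nat list \<Rightarrow> 'a) set" where
  "Cf m scale n = coeff_tensor_sub scale (antisym m n)"

definition Cf_diff ::
  "nat \<Rightarrow> (K \<Rightarrow> 'a::ab_group_add \<Rightarrow> 'a) \<Rightarrow> ((nat list \<Rightarrow> 'a) \<Rightarrow> 'a) \<Rightarrow> nat \<Rightarrow>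
   (nat list \<Rightarrow> 'a) \<Rightarrow> nat list \<Rightarrow> 'a" where
  "Cf_diff m scale RM n = restrict (YB_diff m scale RM n) (Cf m scale n)"

text \<open>The summand \<open>M \<otimes> [V]\<^sub>k \<otimes> ker \<sigma>\<^sub>l\<close> of \<open>M \<otimes> V\<^sup>\<otimes>\<^sup>(\<^sup>k\<^sup>+\<^sup>l\<^sup>)\<close>.\<close>

definition summand ::
  "nat \<Rightarrow> (K \<Rightarrow> 'a::ab_group_add \<Rightarrow> 'a) \<Rightarrow> nat \<Rightarrow> nat \<Rightarrow> (nat list \<Rightarrow> 'a) set" where
  "summand m scale k l = tensor_sub scale k (Cf m scale k) (ker_sigma m l)"

section \<open>The coordinate formulas are the intended tensor products of maps\<close>

lemma finite_words: "finite (words m n)"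
  unfolding words_def using finite_lists_length_eq[of "{1..m}" n] by (simp add: conj_commute)

lemma vector_space_pw:
  assumes "vector_space scale"
  shows "vector_space (pw scale :: K \<Rightarrow> ('i \<Rightarrow> 'a::ab_group_add) \<Rightarrow> _)"
proof -
  interpret vector_space scale by fact
  show ?thesis
    by unfold_locales (auto simp: pw_def fun_eq_iff scale_right_distrib scale_left_distrib)
qed

lemma slice_tensor:
  assumes "vector_space scale" and "f \<in> tensor_space m p"
  shows "slice p z (tensor scale p f b) = pw scale (b z) f"
proof -
  interpret vector_space scale by fact
  show ?thesis
    using assms(2) by (auto simp: slice_def tensor_def pw_def fun_eq_iff tensor_space_def words_def)
qed

lemma map_tensor_id_tensor:
  assumes "vector_space scale" and "X \<subseteq> tensor_space m p" and "linear_on (pw scale) (pw scale') X F"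
    and "f \<in> X"
  shows "map_tensor_id p q F (tensor scale p f b) = tensor scale' q (F f) b"
proof
  fix w
  have "slice p (drop q w) (tensor scale p f b) = pw scale (b (drop q w)) f"
    using slice_tensor assms(1,2,4) by blast
  then show "map_tensor_id p q F (tensor scale p f b) w = tensor scale' q (F f) b w"
    using assms(3,4) by (simp add: map_tensor_id_def linear_on_def tensor_def pw_def[of scale'])
qed

lemma act_tensor_id_tensor:
  assumes "vector_space scale" and "linear_on (pw scale) scale (tensor_space m 1) F"
    and "f \<in> tensor_space m 1"
  shows "act_tensor_id F (tensor scale 1 f b) = pure_tensor scale (F f) b"
  unfolding act_tensor_id_def pure_tensor_def slice_tensor[OF assms(1,3)]
  using assms(2,3) by (simp add: linear_on_def)

lemma id_map_id_tensor:
  assumes "c \<in> tensor_space m p" and "linear_on (pw (*)) (pw (*)) (tensor_space m p) F"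
    and "j \<le> length w"
  shows "id_map_id j p F (tensor (*) j a (tensor (*) p c b)) w
       = tensor (*) j a (tensor (*) p (F c) b) w"
proof -
  have *: "(\<lambda>u. if length u = p
          then tensor (*) j a (tensor (*) p c b) (take j w @ u @ drop (j + p) w) else 0)
      = pw (*) (a (take j w) * b (drop (j + p) w)) c"
    using assms(1,3) by (auto simp: tensor_def pw_def fun_eq_iff tensor_space_def words_def)
  have "F (pw (*) (a (take j w) * b (drop (j + p) w)) c)
      = pw (*) (a (take j w) * b (drop (j + p) w)) (F c)"
    using assms(1,2) by (simp add: linear_on_def)
  then show ?thesis
    unfolding id_map_id_def * by (simp add: tensor_def pw_def add.commute mult_ac)
qed

lemma sum_fun_app: "(\<Sum>u\<in>A. g u) w = (\<Sum>u\<in>A. g u w)"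
  for g :: "'i \<Rightarrow> 'j \<Rightarrow> 'a::comm_monoid_add"
  by (induction A rule: infinite_finite_induct) auto

lemma basis_tensor_in: "u \<in> words m n \<Longrightarrow> basis_tensor u \<in> tensor_space m n"
  by (auto simp: basis_tensor_def tensor_space_def)

lemma vector_space_K: "vector_space ((*) :: K \<Rightarrow> K \<Rightarrow> K)"
  by unfold_locales (auto simp: algebra_simps)

lemma subspace_tensor_space:
  assumes "vector_space scale"
  shows "module.subspace (pw scale) (tensor_space m n)"
proof -
  interpret vector_space scale by fact
  interpret P: vector_space "pw scale" by (rule vector_space_pw) fact
  show ?thesis by (auto simp: P.subspace_def tensor_space_def pw_def)
qed

lemma basis_expansion:
  assumes "b \<in> tensor_space m n"
  shows "b = (\<Sum>u\<in>words m n. pw (*) (b u) (basis_tensor u))"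
proof
  fix w
  have "(\<Sum>u\<in>words m n. b u * (if w = u then 1 else 0)) = (\<Sum>u\<in>words m n. if w = u then b u else 0)"
    by (intro sum.cong) auto
  also have "\<dots> = b w"
    using assms by (auto simp: finite_words tensor_space_def)
  finally show "b w = (\<Sum>u\<in>words m n. pw (*) (b u) (basis_tensor u)) w"
    by (simp add: sum_fun_app pw_def basis_tensor_def)
qed

lemma linear_on_sum:
  assumes "vector_space s" and "vector_space s'" and "module.subspace s W" and "linear_on s s' W F"
    and "finite A" and "\<And>u. u \<in> A \<Longrightarrow> e u \<in> W"
  shows "F (\<Sum>u\<in>A. s (c u) (e u)) = (\<Sum>u\<in>A. s' (c u) (F (e u)))"
proof -
  interpret S: vector_space s by fact
  interpret S': vector_space s' by fact
  have 0: "F 0 = 0"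
    using assms(3,4) S.scale_zero_left[of 0] S'.scale_zero_left
    unfolding linear_on_def S.subspace_def by metis
  show ?thesis
    using assms(5,6)
  proof (induction A rule: finite_induct)
    case empty
    then show ?case by (simp add: 0)
  next
    case (insert x A)
    have "(\<Sum>u\<in>A. s (c u) (e u)) \<in> W" "s (c x) (e x) \<in> W"
      using insert.prems by (auto intro!: S.subspace_sum S.subspace_scale assms(3))
    then show ?case
      using insert assms(4) by (simp add: linear_on_def)
  qed
qed

lemma id_tensor_map_pure:
  assumes "vector_space scale" and "linear_on (pw (*)) (pw (*)) (tensor_space m n) F"
    and "b \<in> tensor_space m n"
  shows "id_tensor_map scale m n F (pure_tensor scale x b) = pure_tensor scale x (F b)"
proof
  fix w
  interpret vector_space scale by fact
  have "F (\<Sum>u\<in>words m n. pw (*) (b u) (basis_tensor u))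
      = (\<Sum>u\<in>words m n. pw (*) (b u) (F (basis_tensor u)))"
    by (rule linear_on_sum[where s = "pw (*)" and W = "tensor_space m n" and F = F])
      (use assms(2) in \<open>auto intro: vector_space_pw vector_space_K subspace_tensor_space
        finite_words basis_tensor_in\<close>)
  then have "F b = (\<Sum>u\<in>words m n. pw (*) (b u) (F (basis_tensor u)))"
    unfolding basis_expansion[OF assms(3), symmetric] .
  then show "id_tensor_map scale m n F (pure_tensor scale x b) w = pure_tensor scale x (F b) w"
    by (simp add: id_tensor_map_def id_tensor_basis_def pure_tensor_def sum_fun_app pw_def
        scale_sum_left mult.commute)
qed

lemma R_op_basis:
  assumes "1 \<le> i" "i \<le> m" "1 \<le> j" "j \<le> m"
  shows "R_op m (basis_tensor [i, j]) = R_basis [i, j]"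
proof
  fix w
  have "R_op m (basis_tensor [i, j]) w = (\<Sum>u\<in>words m 2. if u = [i, j] then R_basis u w else 0)"
    unfolding R_op_def id_tensor_basis_def by (intro sum.cong) (auto simp: basis_tensor_def)
  then show "R_op m (basis_tensor [i, j]) w = R_basis [i, j] w"
    using assms finite_words[of m 2] by (simp add: words_def)
qed

end

theory Submission
  imports Defs "HOL-Computational_Algebra.Polynomial_Factorial"
begin

text \<open>With \<open>q = y\<^sup>2\<close>, the operators \<open>T\<^sub>i = - R\<^sub>i\<close> satisfy the Hecke relations
  \<open>(T\<^sub>i + 1) (T\<^sub>i - q) = 0\<close>, and \<open>\<sigma>\<^sub>n\<close> is the sum of \<open>T\<^sub>1 \<cdots> T\<^sub>k\<^sub>-\<^sub>1\<close> over \<open>1 \<le> k \<le> n\<close>. The joint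
  eigenspace of \<open>T\<^sub>1, ..., T\<^sub>k\<^sub>-\<^sub>1\<close> for \<open>q\<close> is \<open>[V]\<^sub>k \<otimes> V\<^sup>\<otimes>\<^sup>(\<^sup>n\<^sup>-\<^sup>k\<^sup>)\<close>, and on it
  \<open>\<sigma>\<^sub>n = [k] + T\<^sub>1 \<cdots> T\<^sub>k (id \<otimes> \<sigma>\<^sub>n\<^sub>-\<^sub>k)\<close>, where \<open>[k] = 1 + q + ... + q\<^sup>k\<^sup>-\<^sup>1\<close>. The key identity is
  \<open>T\<^sub>1 Z = q Z\<close> for \<open>Z = (id \<otimes> \<sigma>\<^sub>n\<^sub>-\<^sub>1) \<sigma>\<^sub>n\<close>. It implies that \<open>\<Prod>\<^sub>j\<^sub><\<^sub>k (\<sigma>\<^sub>n - [j])\<close> has its image in that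
  joint eigenspace. Hence \<open>\<sigma>\<^sub>n\<close> is a root of \<open>\<Prod>\<^sub>j\<^sub>\<le>\<^sub>n (X - [j])\<close>, whose roots are distinct, and the
  eigenspace of \<open>[k]\<close> is exactly \<open>[V]\<^sub>k \<otimes> ker \<sigma>\<^sub>n\<^sub>-\<^sub>k\<close>: this is the direct sum decomposition.
  The differential is the action of the first tensor factor on \<open>M\<close> after \<open>\<sigma>\<^sub>n\<close>, so that on the
  \<open>k\<close>-th summand it is \<open>[k]\<close> times that action, and it vanishes for \<open>k = 0\<close>. By the wall condition,
  acting twice changes sign under \<open>T\<^sub>1\<close>; by the key identity \<open>\<partial>\<^sup>2\<close> is acting twice after \<open>Z\<close>, so
  \<open>(1 + q) \<partial>\<^sup>2 = 0\<close>.\<close>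

section \<open>Diagonalizable operators\<close>

text \<open>This is the polynomial with the roots \<open>cs\<close>, evaluated at \<open>A\<close>
  and applied to \<open>x\<close>. For linear \<open>A\<close> the factors commute, so that a root
  at either end of the list can be applied last (\<open>P_Cons\<close>,
  \<open>P_snoc\<close>).\<close>

primrec shifted_prod ::
  "('f \<Rightarrow> 'e \<Rightarrow> 'e) \<Rightarrow> ('e \<Rightarrow> 'e) \<Rightarrow> 'f list \<Rightarrow> 'e \<Rightarrow> 'e::ab_group_add" where
  "shifted_prod s A [] x = x"
| "shifted_prod s A (c # cs) x = shifted_prod s A cs (A x - s c x)"

lemma shifted_prod_append:
  "shifted_prod s A (cs @ ds) x = shifted_prod s A ds (shifted_prod s A cs x)"
  by (induction cs arbitrary: x) auto

locale vector_space_endomorphism = vector_space scale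
  for scale :: "'f::field \<Rightarrow> 'e::ab_group_add \<Rightarrow> 'e" (infixr \<open>*s\<close> 75) +
  fixes A :: "'e \<Rightarrow> 'e"
  assumes add: "A (x + y) = A x + A y"
    and scale: "A (c *s x) = c *s A x"
begin

lemma zero: "A 0 = 0"
  using scale[of 0 0] by simp

lemma diff: "A (x - y) = A x - A y"
  using add[of "x - y" y] by simp

lemma sum: "A (\<Sum>i\<in>I. f i) = (\<Sum>i\<in>I. A (f i))"
  by (induction I rule: infinite_finite_induct) (auto simp: zero add)

abbreviation "P \<equiv> shifted_prod scale A"

lemma P_add: "P cs (x + y) = P cs x + P cs y"
  by (induction cs arbitrary: x y) (simp_all add: add scale_right_distrib add_diff_add)

lemma P_scale: "P cs (c *s x) = c *s P cs x"
proof (induction cs arbitrary: x)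
  case (Cons a cs)
  have "A (c *s x) - a *s c *s x = c *s (A x - a *s x)"
    by (simp add: scale scale_right_diff_distrib mult.commute)
  then show ?case using Cons by simp
qed simp

lemma P_diff: "P cs (x - y) = P cs x - P cs y"
  using P_add[of cs "x - y" y] by simp

lemma P_sum: "P cs (\<Sum>i\<in>I. f i) = (\<Sum>i\<in>I. P cs (f i))"
proof (induction I rule: infinite_finite_induct)
  case (insert x F)
  then show ?case by (simp add: P_add)
qed (use P_scale[of cs 0 0] in auto)

lemma P_commute: "P cs (A x) = A (P cs x)"
  by (induction cs arbitrary: x) (simp_all flip: scale diff)

lemma P_Cons: "P (c # cs) x = A (P cs x) - c *s P cs x"
  by (simp add: P_diff P_scale P_commute)

lemma P_snoc: "P (cs @ [c]) x = A (P cs x) - c *s P cs x"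
  by (simp add: shifted_prod_append)

lemma P_eigenvector:
  assumes "A x = a *s x"
  shows "P cs x = (\<Prod>c\<leftarrow>cs. a - c) *s x"
proof (induction cs)
  case (Cons c cs)
  have "P (c # cs) x = P cs ((a - c) *s x)"
    by (simp add: assms scale_left_diff_distrib)
  then show ?case
    using Cons by (simp add: P_scale)
qed simp

text \<open>The vector \<open>y = (A - a n) x\<close> is killed by the remaining factors and
  decomposes by induction. Dividing its components by \<open>a j - a n\<close> gives
  \<open>h\<close>, and \<open>A - a n\<close> kills the difference of \<open>x\<close> and the sum
  of \<open>h\<close>. The subspace \<open>E\<close> is there because the operators act on all
  functions, while the components have to stay in the tensor space.\<close>

lemma eigenvector_decomposition:
  assumes "subspace E" and "\<And>x. x \<in> E \<Longrightarrow> A x \<in> E"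
    and "inj_on a {..<n}" and "x \<in> E" and "P (map a [0..<n]) x = 0"
  shows "\<exists>g. (\<forall>j<n. g j \<in> E \<and> A (g j) = a j *s g j) \<and> x = (\<Sum>j<n. g j)"
  using assms(3-5)
proof (induction n arbitrary: x)
  case 0
  then show ?case by simp
next
  case (Suc n)
  define y where "y = A x - a n *s x"
  have "y \<in> E"
    using Suc.prems assms(1,2) by (simp add: y_def subspace_diff subspace_scale)
  moreover have "P (map a [0..<n]) y = 0"
    using Suc.prems(3) by (simp add: y_def P_snoc P_diff P_scale P_commute)
  moreover have "inj_on a {..<n}"
    using Suc.prems(1) by (rule inj_on_subset) auto
  ultimately obtain g where g: "\<And>j. j < n \<Longrightarrow> g j \<in> E \<and> A (g j) = a j *s g j"
    and y: "y = (\<Sum>j<n. g j)"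
    using Suc.IH by blast
  define h where "h j = (1 / (a j - a n)) *s g j" for j
  have h: "h j \<in> E" "A (h j) = a j *s h j" "A (h j) - a n *s h j = g j" if "j < n" for j
  proof -
    have "a j - a n \<noteq> 0"
      using Suc.prems(1) that by (auto simp: inj_on_def)
    then show "A (h j) - a n *s h j = g j"
      using g[OF that] by (simp add: h_def scale divide_simps mult.commute flip: scale_left_diff_distrib)
    show "h j \<in> E" "A (h j) = a j *s h j"
      using g[OF that] assms(1) by (simp_all add: h_def scale subspace_scale mult.commute)
  qed
  define z where "z = x - (\<Sum>j<n. h j)"
  have "A z - a n *s z = y - (\<Sum>j<n. A (h j) - a n *s h j)"
    by (simp add: z_def y_def diff sum scale_right_diff_distrib scale_sum_right sum_subtractf)
  also have "\<dots> = 0"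
    using h(3) by (simp add: y)
  finally have "A z = a n *s z" by simp
  moreover have "z \<in> E"
    unfolding z_def using Suc.prems assms(1) h(1) by (intro subspace_diff subspace_sum) auto
  ultimately have "(\<forall>j<Suc n. (h(n := z)) j \<in> E \<and> A ((h(n := z)) j) = a j *s (h(n := z)) j) \<and>
      x = (\<Sum>j<Suc n. (h(n := z)) j)"
    using h(1,2) by (auto simp: less_Suc_eq z_def)
  then show ?case by blast
qed

text \<open>Applying \<open>A - a n\<close> to the sum kills its last term and multiplies the others
  by the nonzero scalars \<open>a j - a n\<close>.\<close>

lemma eigenvectors_independent:
  fixes n :: nat
  assumes "inj_on a {..<n}" and "\<And>j. j < n \<Longrightarrow> A (g j) = a j *s g j" and "(\<Sum>j<n. g j) = 0"
    and "j < n"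
  shows "g j = 0"
  using assms
proof (induction n arbitrary: g j)
  case (Suc n)
  have "(\<Sum>j<Suc n. A (g j) - a n *s g j) = A (\<Sum>j<Suc n. g j) - a n *s (\<Sum>j<Suc n. g j)"
    by (simp only: sum_subtractf sum scale_sum_right)
  then have "(\<Sum>j<Suc n. A (g j) - a n *s g j) = 0"
    by (simp only: Suc.prems(3)) (simp add: zero)
  then have "(\<Sum>j<n. (a j - a n) *s g j) = 0"
    using Suc.prems(2) by (simp add: scale_left_diff_distrib)
  moreover have "inj_on a {..<n}"
    using Suc.prems(1) by (rule inj_on_subset) auto
  moreover have "A ((a j - a n) *s g j) = a j *s (a j - a n) *s g j" if "j < n" for j
    using that Suc.prems(2) by (simp add: scale mult.commute)
  ultimately have "(a j - a n) *s g j = 0" if "j < n" for j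
    using Suc.IH[of "\<lambda>j. (a j - a n) *s g j" j] that by blast
  then have *: "g j = 0" if "j < n" for j
    using that inj_onD[OF Suc.prems(1), of j n] by auto
  then have "g n = 0"
    using Suc.prems(3) by simp
  then show ?case
    using * Suc.prems(4) less_Suc_eq by blast
qed simp

end

section \<open>Hecke operators\<close>

primrec hecke_prod :: "(nat \<Rightarrow> 'e \<Rightarrow> 'e) \<Rightarrow> nat \<Rightarrow> nat \<Rightarrow> 'e \<Rightarrow> 'e" where
  "hecke_prod T j 0 x = x"
| "hecke_prod T j (Suc k) x = T j (hecke_prod T (Suc j) k x)"

text \<open>The sum of \<open>T j \<circ> ... \<circ> T (j + i - 1)\<close> for \<open>i < l\<close>: for \<open>T = - R\<close> this is \<open>\<sigma>\<^sub>l\<close>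
  on the factors \<open>j, ..., j + l - 1\<close>.\<close>

primrec hecke_sum :: "(nat \<Rightarrow> 'e \<Rightarrow> 'e) \<Rightarrow> nat \<Rightarrow> nat \<Rightarrow> 'e \<Rightarrow> 'e::ab_group_add" where
  "hecke_sum T j 0 x = 0"
| "hecke_sum T j (Suc l) x = x + T j (hecke_sum T (Suc j) l x)"

definition qint :: "'f::comm_semiring_1 \<Rightarrow> nat \<Rightarrow> 'f" where
  "qint q n = (\<Sum>i<n. q ^ i)"

lemma qint_0 [simp]: "qint q 0 = 0"
  by (simp add: qint_def)

lemma qint_Suc: "qint q (Suc n) = 1 + q * qint q n"
  by (simp add: qint_def lessThan_Suc_eq_insert_0 sum.reindex zero_notin_Suc_image sum_distrib_left)

lemma qint_1 [simp]: "qint q (Suc 0) = 1"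
  by (simp add: qint_def)

lemma qint_add: "qint q (m + n) = qint q m + q ^ m * qint q n"
  by (induction m) (simp_all add: qint_Suc algebra_simps)

text \<open>The difference \<open>[m + d] - [m]\<close> is \<open>q ^ m * [d]\<close>, a product of
  nonzero factors.\<close>

lemma inj_qint:
  fixes q :: "'f::field"
  assumes "q \<noteq> 0" and "\<And>n. n > 0 \<Longrightarrow> qint q n \<noteq> 0"
  shows "inj (qint q)"
proof (rule linorder_injI)
  fix m n :: nat assume "m < n"
  then obtain d where "n = m + d" "d > 0"
    using less_imp_add_positive by blast
  then show "qint q m \<noteq> qint q n"
    using assms by (simp add: qint_add)
qed

text \<open>The operators \<open>T 0, ..., T (n - 2)\<close> represent the Hecke algebra of the symmetric group \<open>S\<^sub>n\<close>.\<close>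

locale hecke_operators = vector_space scale
  for scale :: "'f::field \<Rightarrow> 'e::ab_group_add \<Rightarrow> 'e" (infixr \<open>*s\<close> 75) +
  fixes T :: "nat \<Rightarrow> 'e \<Rightarrow> 'e" and q :: 'f and n :: nat
  assumes T_add: "T i (x + y) = T i x + T i y"
    and T_scale: "T i (c *s x) = c *s T i x"
    and T_quadratic: "T i (T i x) = (q - 1) *s T i x + q *s x"
    and T_commute: "Suc i < j \<Longrightarrow> T i (T j x) = T j (T i x)"
    and T_braid: "Suc (Suc i) < n \<Longrightarrow> T i (T (Suc i) (T i x)) = T (Suc i) (T i (T (Suc i) x))"
    and q_nonzero: "q \<noteq> 0"
    and qint_nonzero: "k > 0 \<Longrightarrow> qint q k \<noteq> 0"
begin

lemma T_zero: "T i 0 = 0"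
  using T_scale[of i 0 0] by simp

lemma T_inj: "T i x = 0 \<Longrightarrow> x = 0"
  using T_quadratic[of i x] q_nonzero by (simp add: T_zero)

text \<open>This is the factorization \<open>(T - q) (T + 1) = 0\<close> of the quadratic
  relation.\<close>

lemma T_one_plus: "T j (x + T j x) = q *s (x + T j x)"
  by (simp add: T_add T_quadratic algebra_simps)

lemma hecke_prod_linear:
  "hecke_prod T j k (x + y) = hecke_prod T j k x + hecke_prod T j k y"
  "hecke_prod T j k (c *s x) = c *s hecke_prod T j k x"
  by (induction k arbitrary: j) (simp_all add: T_add T_scale)

sublocale HP: vector_space_endomorphism scale "hecke_prod T j k" for j k
  by unfold_locales (simp_all add: hecke_prod_linear)

lemma hecke_prod_inj: "hecke_prod T j k x = 0 \<Longrightarrow> x = 0"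
  by (induction k arbitrary: j) (auto dest: T_inj)

lemma hecke_sum_linear:
  "hecke_sum T j l (x + y) = hecke_sum T j l x + hecke_sum T j l y"
  "hecke_sum T j l (c *s x) = c *s hecke_sum T j l x"
  by (induction l arbitrary: j) (simp_all add: T_add T_scale algebra_simps)

lemma T_commute_hecke_prod:
  "Suc i < j \<Longrightarrow> T i (hecke_prod T j k x) = hecke_prod T j k (T i x)"
  by (induction k arbitrary: j) (simp_all add: T_commute)

lemma T_commute_hecke_sum:
  "Suc i < j \<Longrightarrow> T i (hecke_sum T j l x) = hecke_sum T j l (T i x)"
  by (induction l arbitrary: j) (simp_all add: T_commute T_add T_zero)

text \<open>Going through the product from the left, \<open>T (Suc i)\<close> commutes with the
  factors before \<open>T i\<close>. The braid relation carries it over \<open>T i\<close> and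
  \<open>T (Suc i)\<close>, where it becomes \<open>T i\<close>, and this commutes with the later
  factors.\<close>

lemma T_hecke_prod_shift:
  assumes "j \<le> i" "Suc i < j + k" "j + k < n"
  shows "T (Suc i) (hecke_prod T j k x) = hecke_prod T j k (T i x)"
  using assms
proof (induction k arbitrary: j)
  case (Suc k)
  show ?case
  proof (cases "i = j")
    case True
    then obtain k' where k: "k = Suc k'"
      using Suc.prems by (cases k) auto
    have "T (Suc j) (T j (T (Suc j) (hecke_prod T (Suc (Suc j)) k' x)))
        = T j (T (Suc j) (T j (hecke_prod T (Suc (Suc j)) k' x)))"
      using Suc.prems k by (simp add: T_braid)
    then show ?thesis
      by (simp add: k True T_commute_hecke_prod)
  next
    case False
    then show ?thesis
      using Suc by (simp flip: T_commute[of j "Suc i"])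
  qed
qed simp

text \<open>Splitting \<open>\<sigma>\<close> as \<open>1 + T j \<circ> s\<close> and \<open>s\<close> as \<open>1 + T (j + 1) \<circ> u\<close> gives
  \<open>s \<circ> \<sigma> = (1 + T j) \<circ> s + T (j + 1) \<circ> T j \<circ> (u \<circ> s)\<close>, and the braid relation carries the
  eigenvalue of \<open>T (j + 1)\<close> on \<open>u \<circ> s\<close> over to \<open>T j\<close>.\<close>

lemma hecke_sum_hecke_sum_eigenvector:
  assumes "j + Suc l \<le> n"
  defines "z \<equiv> \<lambda>x. hecke_sum T (Suc j) l (hecke_sum T j (Suc l) x)"
  shows "T j (z x) = q *s z x"
  unfolding z_def using assms(1)
proof (induction l arbitrary: j x)
  case 0
  then show ?case by (simp add: T_zero)
next
  case (Suc l)
  define u where "u = hecke_sum T (Suc (Suc j)) l"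
  define s where "s = hecke_sum T (Suc j) (Suc l)"
  have s: "s x = x + T (Suc j) (u x)" for x
    by (simp add: s_def u_def)
  have eq: "s (x + T j (s x)) = (s x + T j (s x)) + T (Suc j) (T j (u (s x)))"
    by (simp add: s[of "x + _"] s[of x] hecke_sum_linear T_add u_def T_commute_hecke_sum[of j "Suc (Suc j)", symmetric]
        add_ac)
  have IH: "T (Suc j) (u (s x)) = q *s u (s x)"
    unfolding u_def s_def using Suc.IH[of "Suc j"] Suc.prems by simp
  have "T j (T (Suc j) (T j (u (s x)))) = q *s T (Suc j) (T j (u (s x)))"
  proof (cases l)
    case 0
    then show ?thesis by (simp add: u_def T_zero)
  next
    case (Suc l')
    then show ?thesis
      using Suc.prems by (simp add: T_braid IH T_scale)
  qed
  then have "T j (s (x + T j (s x))) = q *s s (x + T j (s x))"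
    unfolding eq by (simp add: T_add[of j "s x + T j (s x)"] T_one_plus scale_right_distrib)
  then show ?case
    by (simp add: s_def del: hecke_sum.simps(2)) (simp add: s_def)
qed

text \<open>On tensors this becomes antisymmetry in the first \<open>k\<close> factors
  (\<open>q_invariant_iff_alternating\<close>).\<close>

definition q_invariant :: "nat \<Rightarrow> 'e \<Rightarrow> bool" where
  "q_invariant k x \<longleftrightarrow> (\<forall>i. Suc i < k \<longrightarrow> T i x = q *s x)"

text \<open>The first \<open>k\<close> terms of the sum act on \<open>x\<close> as
  \<open>1, q, ..., q ^ (k - 1)\<close>. All later terms begin with \<open>T j\<close>, ...,
  \<open>T (j + k - 1)\<close>, which is the common factor \<open>hecke_prod T j k\<close>.\<close>

lemma hecke_sum_eigenvector:
  assumes "\<And>i. j \<le> i \<Longrightarrow> Suc i < j + k \<Longrightarrow> T i x = q *s x"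
  shows "hecke_sum T j (k + l) x = qint q k *s x + hecke_prod T j k (hecke_sum T (j + k) l x)"
  using assms
proof (induction k arbitrary: j)
  case (Suc k)
  have "hecke_sum T (Suc j) (k + l) x
      = qint q k *s x + hecke_prod T (Suc j) k (hecke_sum T (Suc j + k) l x)"
    using Suc.prems by (intro Suc.IH) auto
  \<comment> \<open>For \<open>k = 0\<close> nothing is assumed about \<open>T j x\<close>, but then
    the coefficient \<open>qint q 0\<close> is zero.\<close>
  moreover have "qint q k *s T j x = (q * qint q k) *s x"
    using Suc.prems[of j] by (cases k) (auto simp: mult.commute)
  ultimately show ?case
    by (simp add: T_add T_scale qint_Suc scale_left_distrib)
qed simp

lemma hecke_sum_q_invariant:
  assumes "q_invariant k x" and "k \<le> n"
  shows "hecke_sum T 0 n x = qint q k *s x + hecke_prod T 0 k (hecke_sum T k (n - k) x)"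
  using hecke_sum_eigenvector[of 0 k x "n - k"] assms by (simp add: q_invariant_def)

sublocale S: vector_space_endomorphism scale "hecke_sum T j l" for j l
  by unfold_locales (simp_all add: hecke_sum_linear)

abbreviation "eigen_prod k \<equiv> shifted_prod scale (hecke_sum T 0 n) (map (qint q) [0..<k])"

text \<open>By induction the next factor turns the invariant vector \<open>y\<close> into
  \<open>T 0\<close>, ..., \<open>T (k - 1)\<close> applied to a sum over later operators. This form
  settles \<open>T i\<close> for \<open>i > 0\<close>, by the shift relation. For
  \<open>i = 0\<close> the key identity is used instead.\<close>

lemma q_invariant_eigen_prod:
  assumes "k \<le> n"
  shows "q_invariant k (eigen_prod k x)"
  using assms
proof (induction k)
  case 0
  then show ?case by (simp add: q_invariant_def)
next
  case (Suc k)
  define y where "y = eigen_prod k x"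
  have IH: "q_invariant k y"
    using Suc by (simp add: y_def)
  have y': "eigen_prod (Suc k) x = hecke_prod T 0 k (hecke_sum T k (n - k) y)"
    using hecke_sum_q_invariant[OF IH] Suc.prems
    by (simp add: S.P_snoc flip: y_def)
  show ?case
    unfolding q_invariant_def
  proof (intro allI impI)
    fix i assume i: "Suc i < Suc k"
    show "T i (eigen_prod (Suc k) x) = q *s eigen_prod (Suc k) x"
    proof (cases i)
      case 0
      \<comment> \<open>Here \<open>k > 0\<close>, so \<open>[0] = 0\<close> and
        \<open>[1] = 1\<close> are among the roots. Applied last, their factors give
        \<open>\<sigma> (\<sigma> - 1)\<close>, and \<open>\<sigma> - 1\<close> is
        \<open>T 0\<close> after a shorter sum.\<close>
      define z where "z = shifted_prod scale (hecke_sum T 0 n) (map (qint q) [2..<Suc k]) x"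
      have "[0..<Suc k] = 0 # Suc 0 # [2..<Suc k]"
        using i by (simp add: upt_conv_Cons numeral_2_eq_2 del: upt_Suc)
      then have "eigen_prod (Suc k) x
          = hecke_sum T 0 n (hecke_sum T 0 n z) - hecke_sum T 0 n z"
        by (simp only: list.map S.P_Cons flip: z_def) (simp add: S.diff)
      also have "\<dots> = T 0 (hecke_sum T (Suc 0) (n - 1) (hecke_sum T 0 (Suc (n - 1)) z))"
        using Suc.prems by (cases n) simp_all
      finally have z: "eigen_prod (Suc k) x
          = T 0 (hecke_sum T (Suc 0) (n - 1) (hecke_sum T 0 (Suc (n - 1)) z))" .
      show ?thesis
        unfolding z 0 using hecke_sum_hecke_sum_eigenvector[of 0 "n - 1" z] Suc.prems
        by (simp add: T_scale del: hecke_sum.simps)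
    next
      case (Suc i')
      show ?thesis
      proof (cases "k < n")
        case True
        \<comment> \<open>Shifted through the product, \<open>T i\<close> becomes
          \<open>T i'\<close>, which commutes with the sum starting at \<open>k\<close> and reaches
          \<open>y\<close>.\<close>
        have "T i (hecke_prod T 0 k (hecke_sum T k (n - k) y))
            = hecke_prod T 0 k (hecke_sum T k (n - k) (T i' y))"
          using i Suc True by (simp add: T_hecke_prod_shift T_commute_hecke_sum)
        also have "\<dots> = q *s hecke_prod T 0 k (hecke_sum T k (n - k) y)"
          using IH i Suc by (simp add: q_invariant_def S.scale hecke_prod_linear)
        finally show ?thesis by (simp only: y')
      next
        case False
        then show ?thesis
          using Suc.prems by simp
      qed
    qed
  qed
qed

text \<open>On a vector invariant for \<open>k = n\<close> the remainder in
  \<open>hecke_sum_q_invariant\<close> is an empty sum, so \<sigma> is the scalar \<open>[n]\<close>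
  and the last factor kills it.\<close>

lemma eigen_prod_Suc_n: "eigen_prod (Suc n) x = 0"
  using hecke_sum_q_invariant[OF q_invariant_eigen_prod[of n x]] hecke_prod_linear(2)[of 0 n 0 0]
  by (simp add: S.P_snoc)

text \<open>On an eigenvector for \<open>[k]\<close>, the operator \<open>eigen_prod k\<close> is a
  nonzero scalar, so the vector inherits the invariance of its image. The kernel condition is then
  the vanishing of the remainder, because \<open>hecke_prod\<close> is injective.\<close>

lemma eigenvector_iff:
  assumes "k \<le> n"
  shows "hecke_sum T 0 n x = qint q k *s x \<longleftrightarrow> q_invariant k x \<and> hecke_sum T k (n - k) x = 0"
proof
  assume x: "hecke_sum T 0 n x = qint q k *s x"
  have "qint q k \<noteq> qint q j" if "j < k" for j
    using that injD[OF inj_qint[of q], of k j] q_nonzero qint_nonzero by auto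
  then have "(\<Prod>c\<leftarrow>map (qint q) [0..<k]. qint q k - c) \<noteq> 0"
    by (fastforce simp: prod_list_zero_iff)
  then obtain c where "c \<noteq> 0" "eigen_prod k x = c *s x"
    using S.P_eigenvector[OF x] by blast
  then have "q_invariant k (c *s x)"
    using q_invariant_eigen_prod[OF assms, of x] by simp
  then have inv: "q_invariant k x"
    using \<open>c \<noteq> 0\<close> unfolding q_invariant_def by (metis T_scale scale_left_commute scale_left_imp_eq)
  then have "hecke_prod T 0 k (hecke_sum T k (n - k) x) = 0"
    using hecke_sum_q_invariant[OF inv assms] x by simp
  then show "q_invariant k x \<and> hecke_sum T k (n - k) x = 0"
    using inv hecke_prod_inj by blast
next
  assume "q_invariant k x \<and> hecke_sum T k (n - k) x = 0"
  then show "hecke_sum T 0 n x = qint q k *s x"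
    using hecke_sum_q_invariant[OF _ assms] hecke_prod_linear(2)[of 0 k 0 0] by simp
qed

end

text \<open>The offsets serve two uses: tensoring with a fixed left factor raises the index of each
  operator, and letting the first factor act on the module lowers it by one. The latter map is
  additive on a tensor space only, hence \<open>E\<close>.\<close>

lemma hecke_intertwine:
  assumes zero: "0 \<in> E" "\<phi> 0 = 0"
    and add: "\<And>x y. x \<in> E \<Longrightarrow> y \<in> E \<Longrightarrow> x + y \<in> E \<and> \<phi> (x + y) = \<phi> x + \<phi> y"
    and T: "\<And>i x. x \<in> E \<Longrightarrow> T (i + c) x \<in> E \<and> \<phi> (T (i + c) x) = T' (i + d) (\<phi> x)"
    and "x \<in> E"
  shows "\<phi> (hecke_prod T (j + c) k x) = hecke_prod T' (j + d) k (\<phi> x)"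
    and "\<phi> (hecke_sum T (j + c) k x) = hecke_sum T' (j + d) k (\<phi> x)"
proof -
  have "hecke_prod T (j + c) k x \<in> E \<and> \<phi> (hecke_prod T (j + c) k x) = hecke_prod T' (j + d) k (\<phi> x)"
    by (induction k arbitrary: j) (simp_all add: \<open>x \<in> E\<close> T flip: add_Suc)
  then show "\<phi> (hecke_prod T (j + c) k x) = hecke_prod T' (j + d) k (\<phi> x)" by simp
  have "hecke_sum T (j + c) k x \<in> E \<and> \<phi> (hecke_sum T (j + c) k x) = hecke_sum T' (j + d) k (\<phi> x)"
    by (induction k arbitrary: j) (simp_all add: \<open>x \<in> E\<close> zero T add flip: add_Suc)
  then show "\<phi> (hecke_sum T (j + c) k x) = hecke_sum T' (j + d) k (\<phi> x)" by simp
qed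

lemma hecke_sum_eq_sum:
  assumes "\<And>i x y. T i (x + y) = T i x + T i y"
  shows "hecke_sum T j l x = (\<Sum>i<l. hecke_prod T j i x)"
proof (induction l arbitrary: j)
  case (Suc l)
  have "T j 0 = 0"
    using assms[of j 0 0] by simp
  then have "T j (\<Sum>i<l. f i) = (\<Sum>i<l. T j (f i))" for f :: "nat \<Rightarrow> 'a"
    by (induction l) (simp_all add: assms)
  then show ?case
    by (simp add: Suc lessThan_Suc_eq_insert_0 sum.reindex zero_notin_Suc_image)
qed simp

section \<open>The parameter \<open>q = y\<^sup>2\<close> in the ground field\<close>

lemma yK_eq: "yK = to_fract [:0, 1:]"
  by (simp add: yK_def to_fract_def)

lemma to_fract_power: "to_fract (x ^ n) = to_fract x ^ n"
  by (induction n) simp_all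

lemma to_fract_sum: "to_fract (\<Sum>i\<in>I. f i) = (\<Sum>i\<in>I. to_fract (f i))"
  by (induction I rule: infinite_finite_induct) simp_all

definition qK :: K where
  "qK = yK\<^sup>2"

lemma qK_nonzero: "qK \<noteq> 0"
  by (simp add: qK_def yK_eq)

text \<open>As a polynomial in \<open>y\<close>, the element \<open>[k]\<close> has constant term
  1.\<close>

lemma qint_qK_nonzero:
  assumes "k > 0"
  shows "qint qK k \<noteq> 0"
proof -
  have eq: "qint qK k = to_fract (\<Sum>i<k. [:0, 1:] ^ (2 * i))"
    by (simp add: qint_def qK_def yK_eq to_fract_sum to_fract_power power_mult)
  have "poly (\<Sum>i<k. [:0, 1:] ^ (2 * i)) (0 :: complex) = (\<Sum>i<k. if i = 0 then 1 else 0)"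
    unfolding poly_sum by (intro sum.cong) (auto simp: poly_power)
  also have "\<dots> = 1"
    using assms by simp
  finally show ?thesis
    unfolding eq to_fract_eq_0_iff by (metis poly_0 zero_neq_one)
qed

lemma fact_K_nonzero: "(of_nat (fact k) :: K) \<noteq> 0"
proof -
  have "(of_nat (fact k) :: K) = to_fract (of_nat (fact k))"
    by (simp add: to_fract_def of_nat_fract)
  then show ?thesis
    by (simp del: of_nat_fact)
qed

section \<open>The Hecke operators on tensors\<close>

definition swap_adj :: "nat \<Rightarrow> 'b list \<Rightarrow> 'b list" where
  "swap_adj i w = w[i := w ! Suc i, Suc i := w ! i]"

lemma swap_adj_append [simp]: "swap_adj (length xs) (xs @ a # b # ys) = xs @ b # a # ys"
  by (simp add: swap_adj_def list_update_append nth_append)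

lemma length_swap_adj [simp]: "length (swap_adj i w) = length w"
  by (simp add: swap_adj_def)

lemma split_adj:
  assumes "Suc i < length w"
  obtains xs a b ys where "w = xs @ a # b # ys" "length xs = i"
proof -
  have "w = take i w @ w ! i # w ! Suc i # drop (Suc (Suc i)) w" "length (take i w) = i"
    using assms by (simp_all add: Cons_nth_drop_Suc)
  then show thesis using that by blast
qed

lemma swap_adj_eq_permute_list:
  assumes "Suc i < length w"
  shows "swap_adj i w = permute_list (transpose i (Suc i)) w"
  using assms by (intro nth_equalityI)
    (auto simp: swap_adj_def permute_list_def transpose_def nth_list_update)

lemma swap_adj_in_words_iff:
  assumes "Suc i < length w"
  shows "swap_adj i w \<in> words m n \<longleftrightarrow> w \<in> words m n"
  using assms
proof (rule split_adj)
  fix xs a b ys assume "w = xs @ a # b # ys" "length xs = i"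
  moreover from this have "swap_adj i w = xs @ b # a # ys" by auto
  ultimately show ?thesis by (simp add: words_def conj_ac)
qed

text \<open>This is \<open>- (id \<otimes> R \<otimes> id)\<close> with \<open>i\<close> factors to the left of \<open>R\<close>; the sign turns the relation
  \<open>(R - 1) (R + y\<^sup>2) = 0\<close> into that of the Hecke algebra with parameter \<open>y\<^sup>2\<close>. With the value
  \<open>- f w\<close> off the words of length \<open>n\<close>, the relations hold on all functions.\<close>

definition hecke_T ::
  "(K \<Rightarrow> 'a \<Rightarrow> 'a) \<Rightarrow> nat \<Rightarrow> nat \<Rightarrow> (nat list \<Rightarrow> 'a::ab_group_add) \<Rightarrow> nat list \<Rightarrow> 'a" where
  "hecke_T scale n i f w =
     (if length w = n \<and> Suc i < n then
        if w ! i < w ! Suc i then scale (qK - 1) (f w) - f (swap_adj i w)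
        else if w ! Suc i < w ! i then - scale (qK) (f (swap_adj i w))
        else - f w
      else - f w)"

text \<open>With the word split around the two letters concerned, no list updates remain, and the
  Hecke relations reduce to case distinctions on the order of letters.\<close>

lemma hecke_T_append:
  "hecke_T scale (length xs + Suc (Suc (length ys))) (length xs) f (xs @ a # b # ys) =
     (if a < b then scale (qK - 1) (f (xs @ a # b # ys)) - f (xs @ b # a # ys)
      else if b < a then - scale (qK) (f (xs @ b # a # ys))
      else - f (xs @ a # b # ys))"
  by (simp add: hecke_T_def nth_append)

lemma hecke_T_trivial: "\<not> (length w = n \<and> Suc i < n) \<Longrightarrow> hecke_T scale n i f w = - f w"
  by (auto simp: hecke_T_def)

lemma hecke_T_in_tensor_space:
  assumes "vector_space scale" and "f \<in> tensor_space m n"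
  shows "hecke_T scale n i f \<in> tensor_space m n"
proof -
  interpret vector_space scale by fact
  show ?thesis
    using assms(2) by (auto simp: tensor_space_def hecke_T_def swap_adj_in_words_iff)
qed

locale tensor_module = vector_space scale
  for scale :: "K \<Rightarrow> 'a::ab_group_add \<Rightarrow> 'a"
begin

sublocale P: vector_space "pw scale :: K \<Rightarrow> (nat list \<Rightarrow> 'a) \<Rightarrow> nat list \<Rightarrow> 'a"
  by (rule vector_space_pw) unfold_locales

lemma hecke_T_quadratic:
  "hecke_T scale n i (hecke_T scale n i f) w = scale (qK - 1) (hecke_T scale n i f w) + scale (qK) (f w)"
proof (cases "length w = n \<and> Suc i < n")
  case False
  then show ?thesis by (simp add: hecke_T_trivial scale_left_diff_distrib)
next
  case True
  then obtain xs a b ys where w: "w = xs @ a # b # ys" and i: "i = length xs"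
    by (metis split_adj)
  have n: "n = length xs + Suc (Suc (length ys))"
    using True w by simp
  show ?thesis
    unfolding w i n hecke_T_append
    by (auto simp: algebra_simps)
qed

lemma hecke_T_commute:
  assumes "Suc i < j"
  shows "hecke_T scale n i (hecke_T scale n j f) w = hecke_T scale n j (hecke_T scale n i f) w"
proof (cases "length w = n \<and> Suc j < n")
  case False
  then show ?thesis using assms
    by (auto simp: hecke_T_def scale_minus_right)
next
  case True
  then obtain us c d zs where w': "w = us @ c # d # zs" and us: "length us = j"
    by (metis split_adj)
  then obtain xs a b ys where us': "us = xs @ a # b # ys" and i: "i = length xs"
    using assms split_adj by metis
  have j: "j = length (xs @ a # b # ys)" and n: "n = length xs + Suc (Suc (length ys + Suc (Suc (length zs))))"
    and n': "n = length (xs @ a # b # ys) + Suc (Suc (length zs))"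
    using True w' us us' by simp_all
  have 1: "hecke_T scale n i g (xs @ a # b # ys @ c # d # zs) =
     (if a < b then scale (qK - 1) (g (xs @ a # b # ys @ c # d # zs)) - g (xs @ b # a # ys @ c # d # zs)
      else if b < a then - scale (qK) (g (xs @ b # a # ys @ c # d # zs))
      else - g (xs @ a # b # ys @ c # d # zs))" for g a b c d
    using hecke_T_append[of scale xs "ys @ c # d # zs" g a b] by (simp add: i n)
  have 2: "hecke_T scale n j g (xs @ a # b # ys @ c # d # zs) =
     (if c < d then scale (qK - 1) (g (xs @ a # b # ys @ c # d # zs)) - g (xs @ a # b # ys @ d # c # zs)
      else if d < c then - scale (qK) (g (xs @ a # b # ys @ d # c # zs))
      else - g (xs @ a # b # ys @ c # d # zs))" for g a b c d
    using hecke_T_append[of scale "xs @ a # b # ys" zs g c d] by (simp add: j n add.assoc)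
  have w: "w = xs @ a # b # ys @ c # d # zs"
    by (simp add: w' us')
  show ?thesis
    unfolding w 1 2 by (auto simp: scale_right_diff_distrib mult.commute)
qed

lemma hecke_T_braid:
  assumes "Suc (Suc i) < n"
  shows "hecke_T scale n i (hecke_T scale n (Suc i) (hecke_T scale n i f)) w
    = hecke_T scale n (Suc i) (hecke_T scale n i (hecke_T scale n (Suc i) f)) w"
proof (cases "length w = n")
  case False
  then show ?thesis by (simp add: hecke_T_trivial)
next
  case True
  then obtain xs a us where "w = xs @ a # us" and i: "i = length xs"
    using assms split_adj[of i w] by (metis Suc_lessD)
  moreover from this obtain b c ys where "us = b # c # ys"
    using True assms by (cases us; cases "tl us") auto
  ultimately have w: "w = xs @ a # b # c # ys" by simp
  have n: "n = length xs + Suc (Suc (Suc (length ys)))"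
    using True w by simp
  \<comment> \<open>Both operators are written on the same normal form of the word, so that
    compositions unfold by rewriting. They are needed for all letters, since the inner operators see
    permuted words.\<close>
  have 1: "hecke_T scale n i g (xs @ a # b # c # ys) =
     (if a < b then scale (qK - 1) (g (xs @ a # b # c # ys)) - g (xs @ b # a # c # ys)
      else if b < a then - scale (qK) (g (xs @ b # a # c # ys))
      else - g (xs @ a # b # c # ys))" for g a b c
    using hecke_T_append[of scale xs "c # ys" g a b] by (simp add: i n)
  have 2: "hecke_T scale n (Suc i) g (xs @ a # b # c # ys) =
     (if b < c then scale (qK - 1) (g (xs @ a # b # c # ys)) - g (xs @ a # c # b # ys)
      else if c < b then - scale (qK) (g (xs @ a # c # b # ys))
      else - g (xs @ a # b # c # ys))" for g a b c
    using hecke_T_append[of scale "xs @ [a]" ys g b c] by (simp add: i n)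
  show ?thesis
    unfolding w 1 2
    by (auto simp: scale_right_diff_distrib scale_left_diff_distrib algebra_simps)
qed

sublocale H: hecke_operators "pw scale" "hecke_T scale n" "qK" n for n
proof
  fix i j :: nat and f g :: "nat list \<Rightarrow> 'a" and c :: K
  show "hecke_T scale n i (f + g) = hecke_T scale n i f + hecke_T scale n i g"
    by (auto simp: hecke_T_def fun_eq_iff scale_right_distrib)
  show "hecke_T scale n i (pw scale c f) = pw scale c (hecke_T scale n i f)"
    by (auto simp: hecke_T_def fun_eq_iff pw_def scale_right_diff_distrib mult.commute)
  show "hecke_T scale n i (hecke_T scale n i f)
      = pw scale (qK - 1) (hecke_T scale n i f) + pw scale (qK) f"
    by (simp add: fun_eq_iff hecke_T_quadratic pw_def)
  show "hecke_T scale n i (hecke_T scale n j f) = hecke_T scale n j (hecke_T scale n i f)"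
    if "Suc i < j"
    using that by (intro ext hecke_T_commute)
  show "hecke_T scale n i (hecke_T scale n (Suc i) (hecke_T scale n i f))
      = hecke_T scale n (Suc i) (hecke_T scale n i (hecke_T scale n (Suc i) f))"
    if "Suc (Suc i) < n"
    using that by (simp add: fun_eq_iff hecke_T_braid)
qed (simp_all add: qK_nonzero qint_qK_nonzero)

end

interpretation K: tensor_module "(*) :: K \<Rightarrow> K \<Rightarrow> K"
  by (simp add: tensor_module_def vector_space_K)

section \<open>The Yang-Baxter operator and \<sigma> in terms of Hecke operators\<close>

lemma R_basis_pair:
  "R_basis [c, d] w =
     (if c < d then (1 - qK) * (if w = [c, d] then 1 else 0) + qK * (if w = [d, c] then 1 else 0)
      else if w = [d, c] then 1 else 0)"
  by (simp add: R_basis_def basis_tensor_def qK_def)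

lemma R_basis_other: "w \<noteq> [c, d] \<Longrightarrow> w \<noteq> [d, c] \<Longrightarrow> R_basis [c, d] w = 0"
  by (simp add: R_basis_pair)

lemma words_2E:
  assumes "u \<in> words m 2"
  obtains c d where "u = [c, d]" "c \<in> {1..m}" "d \<in> {1..m}"
proof -
  have len: "length u = 2" and set: "set u \<subseteq> {1..m}"
    using assms by (simp_all add: words_def)
  then obtain c v where u: "u = c # v" and v: "length v = 1"
    by (cases u) simp_all
  then obtain d where "v = [d]"
    by (cases v) simp_all
  then show thesis
    using that[of c d] set u by simp
qed

text \<open>The definition of \<open>R\<close> gives images of basis tensors, while
  \<open>hecke_T\<close> gives coefficients of images. Only \<open>[a, b]\<close> and
  \<open>[b, a]\<close> contribute to the coefficient at \<open>[a, b]\<close>: it is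
  \<open>(1 - q) f [a, b] + f [b, a]\<close> for \<open>a < b\<close> and \<open>q f [b, a]\<close>
  for \<open>a > b\<close>.\<close>

lemma R_basis_expansion:
  assumes "vector_space scale" and "a \<in> {1..m}" and "b \<in> {1..m}"
  shows "(\<Sum>u\<in>words m 2. scale (R_basis u [a, b]) (f u)) = - hecke_T scale 2 0 f [a, b]"
proof -
  interpret vector_space scale by fact
  have sub: "{[a, b], [b, a]} \<subseteq> words m 2"
    using assms(2,3) by (simp add: words_def)
  have zero: "R_basis u [a, b] = 0" if "u \<in> words m 2 - {[a, b], [b, a]}" for u
  proof -
    have "u \<in> words m 2"
      using that by simp
    then obtain c d where u: "u = [c, d]" "c \<in> {1..m}" "d \<in> {1..m}"
      by (rule words_2E)
    have "[a, b] \<noteq> [c, d]"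
      using that u(1) by blast
    moreover have "[a, b] \<noteq> [d, c]"
    proof
      assume "[a, b] = [d, c]"
      then have "u = [b, a]"
        using u(1) by simp
      then show False
        using that by blast
    qed
    ultimately show ?thesis
      unfolding u(1) by (rule R_basis_other)
  qed
  have "(\<Sum>u\<in>words m 2. scale (R_basis u [a, b]) (f u))
      = (\<Sum>u\<in>{[a, b], [b, a]}. scale (R_basis u [a, b]) (f u))"
    by (rule sum.mono_neutral_right[OF finite_words sub]) (use zero scale_zero_left in metis)
  also have "\<dots> = - hecke_T scale 2 0 f [a, b]"
  proof (cases a b rule: linorder_cases)
    case less
    then show ?thesis
      by (simp add: R_basis_pair hecke_T_def swap_adj_def scale_left_diff_distrib)
  next
    case equal
    then show ?thesis
      by (simp add: R_basis_pair hecke_T_def)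
  next
    case greater
    then show ?thesis
      by (simp add: R_basis_pair hecke_T_def swap_adj_def)
  qed
  finally show ?thesis .
qed

lemma R_basis_eq_0:
  assumes "u \<in> words m 2" and "w \<notin> words m 2"
  shows "R_basis u w = 0"
proof -
  obtain c d where u: "u = [c, d]" "c \<in> {1..m}" "d \<in> {1..m}"
    using assms(1) by (rule words_2E)
  then have "w \<noteq> [c, d]" "w \<noteq> [d, c]"
    using assms(2) by (auto simp: words_def)
  then show ?thesis
    unfolding u(1) by (rule R_basis_other)
qed

lemma id_tensor_map_R_op:
  assumes "vector_space scale" and "f \<in> tensor_space m 2"
  shows "id_tensor_map scale m 2 (R_op m) f = - hecke_T scale 2 0 f"
proof
  fix w
  interpret vector_space scale by fact
  have "R_op m (basis_tensor u) = R_basis u" if "u \<in> words m 2" for u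
  proof -
    from that obtain c d where "u = [c, d]" "c \<in> {1..m}" "d \<in> {1..m}"
      by (rule words_2E)
    then show ?thesis by (simp add: R_op_basis)
  qed
  then have "id_tensor_map scale m 2 (R_op m) f w = (\<Sum>u\<in>words m 2. scale (R_basis u w) (f u))"
    by (simp add: id_tensor_map_def id_tensor_basis_def)
  also have "\<dots> = - hecke_T scale 2 0 f w"
  proof (cases "w \<in> words m 2")
    case True
    then obtain a b where "w = [a, b]" "a \<in> {1..m}" "b \<in> {1..m}"
      by (rule words_2E)
    then show ?thesis
      using R_basis_expansion[OF assms(1)] by simp
  next
    case False
    then have "hecke_T scale 2 0 f w = 0"
      using hecke_T_in_tensor_space[OF assms] by (simp add: tensor_space_def)
    then show ?thesis
      using False by (simp add: R_basis_eq_0)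
  qed
  finally show "id_tensor_map scale m 2 (R_op m) f w = (- hecke_T scale 2 0 f) w" by simp
qed

lemma id_map_id_R_op:
  assumes "f \<in> tensor_space m n" and "Suc j < n"
  shows "id_map_id j 2 (R_op m) f = - hecke_T (*) n j f"
proof
  fix w
  define g where "g u = (if length u = 2 then f (take j w @ u @ drop (j + 2) w) else 0)" for u
  have eq: "id_map_id j 2 (R_op m) f w = (\<Sum>u\<in>words m 2. R_basis u (take 2 (drop j w)) * g u)"
    by (simp add: id_map_id_def R_op_def id_tensor_basis_def g_def)
  have hecke_0: "hecke_T (*) n j f w = 0" if "w \<notin> words m n"
    using hecke_T_in_tensor_space[OF vector_space_K assms(1)] that by (simp add: tensor_space_def)
  show "id_map_id j 2 (R_op m) f w = (- hecke_T (*) n j f) w"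
  proof (cases "take 2 (drop j w) \<in> words m 2")
    case False
    then have "w \<notin> words m n"
      using assms(2) by (auto simp: words_def dest!: in_set_takeD in_set_dropD)
    then show ?thesis
      using False by (simp add: eq R_basis_eq_0 hecke_0)
  next
    case True
    then have "Suc j < length w"
      by (auto simp: words_def)
    then obtain xs a b ys where w: "w = xs @ a # b # ys" and j: "j = length xs"
      by (metis split_adj)
    have ab: "a \<in> {1..m}" "b \<in> {1..m}" and t: "take 2 (drop j w) = [a, b]"
      using True by (simp_all add: w j words_def numeral_2_eq_2)
    have g: "g [c, d] = f (xs @ c # d # ys)" for c d
      by (simp add: g_def w j)
    have "id_map_id j 2 (R_op m) f w = - hecke_T (*) 2 0 g [a, b]"
      unfolding eq t by (rule R_basis_expansion[OF vector_space_K ab])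
    also have "\<dots> = - hecke_T (*) n j f w"
    proof (cases "length w = n")
      case True
      then have n: "n = length xs + Suc (Suc (length ys))"
        by (simp add: w)
      have "hecke_T (*) n j f w = hecke_T (*) 2 0 g [a, b]"
        by (subst w, subst j, subst n, subst hecke_T_append) (simp add: hecke_T_def swap_adj_def g)
      then show ?thesis by simp
    \<comment> \<open>For a word of the wrong length both sides vanish: \<open>f\<close> is zero on
      it and on its rearrangements, and \<open>hecke_T\<close> preserves the tensor space.\<close>
    next
      case False
      then have "f (xs @ c # d # ys) = 0" for c d
        using assms(1) False by (simp add: tensor_space_def words_def w)
      moreover have "w \<notin> words m n"
        using False by (simp add: words_def)
      ultimately show ?thesis
        by (simp add: hecke_0 hecke_T_def[of _ 2 0] swap_adj_def g)
    qed
    finally show ?thesis by simp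
  qed
qed

lemma tensor_space_add:
  fixes f g :: "nat list \<Rightarrow> 'a::ab_group_add"
  shows "f \<in> tensor_space m n \<Longrightarrow> g \<in> tensor_space m n \<Longrightarrow> f + g \<in> tensor_space m n"
  by (auto simp: tensor_space_def)

lemma tensor_space_zero: "0 \<in> tensor_space m n"
  by (simp add: tensor_space_def)

context tensor_module
begin

lemma hecke_prod_in_tensor_space:
  "f \<in> tensor_space m n \<Longrightarrow> hecke_prod (hecke_T scale n) j k f \<in> tensor_space m n"
  by (induction k arbitrary: j) (simp_all add: hecke_T_in_tensor_space[OF vector_space_axioms])

lemma hecke_sum_in_tensor_space:
  "f \<in> tensor_space m n \<Longrightarrow> hecke_sum (hecke_T scale n) j k f \<in> tensor_space m n"
  by (induction k arbitrary: j)
    (simp_all add: hecke_T_in_tensor_space[OF vector_space_axioms] tensor_space_add tensor_space_zero)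

end

text \<open>Each of the \<open>k - 1\<close> copies of \<open>R\<close> is minus a Hecke operator.
  The resulting sign cancels the alternating sign in \<open>sigma\<close> and in
  \<open>YB_diff\<close>.\<close>

lemma d_op_eq_hecke_prod:
  assumes "f \<in> tensor_space m n" and "k \<in> {1..n}"
  shows "d_op m k f = pw (*) ((-1) ^ (k - 1)) (hecke_prod (hecke_T (*) n) 0 (k - 1) f)"
proof -
  have "foldr (\<circ>) (map (\<lambda>j. id_map_id j 2 (R_op m)) [j..<j + l]) id f
      = pw (*) ((-1) ^ l) (hecke_prod (hecke_T (*) n) j l f)" if "j + l < n" for j l
    using that
  proof (induction l arbitrary: j)
    case 0
    then show ?case by (simp add: pw_def)
  next
    case (Suc l)
    have "[j..<j + Suc l] = j # [Suc j..<Suc j + l]"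
      by (simp add: upt_conv_Cons del: upt_Suc)
    moreover have "foldr (\<circ>) (map (\<lambda>j. id_map_id j 2 (R_op m)) [Suc j..<Suc j + l]) id f
        = pw (*) ((-1) ^ l) (hecke_prod (hecke_T (*) n) (Suc j) l f)"
      using Suc.prems by (intro Suc.IH) simp
    ultimately have "foldr (\<circ>) (map (\<lambda>j. id_map_id j 2 (R_op m)) [j..<j + Suc l]) id f
        = id_map_id j 2 (R_op m) (pw (*) ((-1) ^ l) (hecke_prod (hecke_T (*) n) (Suc j) l f))"
      by (simp only: list.map foldr.simps comp_apply)
    also have "\<dots> = - hecke_T (*) n j (pw (*) ((-1) ^ l) (hecke_prod (hecke_T (*) n) (Suc j) l f))"
      using Suc.prems K.hecke_prod_in_tensor_space[OF assms(1)] subspace_tensor_space[OF vector_space_K]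
      by (intro id_map_id_R_op) (auto simp: K.P.subspace_scale)
    also have "\<dots> = pw (*) ((-1) ^ Suc l) (hecke_prod (hecke_T (*) n) j (Suc l) f)"
      unfolding K.H.T_scale by (simp add: pw_def fun_eq_iff)
    finally show ?case .
  qed
  from this[of 0 "k - 1"] show ?thesis
    using assms(2) by (auto simp: d_op_def)
qed

lemma sigma_eq_hecke_sum:
  assumes "f \<in> tensor_space m n"
  shows "sigma m n f = hecke_sum (hecke_T (*) n) 0 n f"
proof
  fix w
  have "sigma m n f w = (\<Sum>k = 1..n. hecke_prod (hecke_T (*) n) 0 (k - 1) f w)"
    unfolding sigma_def
    by (intro sum.cong) (auto simp: d_op_eq_hecke_prod[OF assms] pw_def)
  also have "\<dots> = (\<Sum>k<n. hecke_prod (hecke_T (*) n) 0 k f w)"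
    by (rule sum.reindex_bij_witness[of _ Suc "\<lambda>k. k - 1"]) auto
  also have "\<dots> = hecke_sum (hecke_T (*) n) 0 n f w"
    by (simp add: hecke_sum_eq_sum K.H.T_add sum_fun_app)
  finally show "sigma m n f w = hecke_sum (hecke_T (*) n) 0 n f w" .
qed

lemma ker_sigma_eq: "ker_sigma m n = {f \<in> tensor_space m n. hecke_sum (hecke_T (*) n) 0 n f = 0}"
  by (auto simp: ker_sigma_def sigma_eq_hecke_sum)

lemma subspace_ker_sigma: "K.P.subspace (ker_sigma m n)"
  using subspace_tensor_space[OF vector_space_K]
  by (auto simp: ker_sigma_eq K.P.subspace_def K.H.hecke_sum_linear K.H.S.zero)

context tensor_module
begin

lemma tensor_add_right: "tensor scale k h (b + b') = tensor scale k h b + tensor scale k h b'"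
  by (simp add: tensor_def fun_eq_iff scale_left_distrib)

lemma tensor_zero_right: "tensor scale k h 0 = 0"
  by (simp add: tensor_def fun_eq_iff)

lemma tensor_scale_right: "tensor scale k h (pw (*) c b) = pw scale c (tensor scale k h b)"
  by (simp add: tensor_def fun_eq_iff pw_def)

lemma hecke_T_tensor:
  "hecke_T scale (k + l) (k + i) (tensor scale k h b) = tensor scale k h (hecke_T (*) l i b)"
proof
  fix w
  show "hecke_T scale (k + l) (k + i) (tensor scale k h b) w = tensor scale k h (hecke_T (*) l i b) w"
  proof (cases "length w = k + l \<and> Suc (k + i) < k + l")
    case True
    have "drop k (swap_adj (k + i) w) = swap_adj i (drop k w)"
      "take k (swap_adj (k + i) w) = take k w"
      using True by (simp_all add: swap_adj_def drop_update_swap)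
    then show ?thesis
      using True by (simp add: hecke_T_def tensor_def scale_left_diff_distrib)
  next
    case False
    \<comment> \<open>For a word shorter than \<open>k\<close> the dropped part is empty, so its
      length could be \<open>l\<close> only for \<open>l = 0\<close>.\<close>
    then have "\<not> (length (drop k w) = l \<and> Suc i < l)"
      by (cases "length w \<ge> k") auto
    then show ?thesis
      using False by (simp add: hecke_T_trivial tensor_def)
  qed
qed

lemma hecke_sum_tensor:
  "hecke_sum (hecke_T scale (k + l)) k j (tensor scale k h b)
    = tensor scale k h (hecke_sum (hecke_T (*) l) 0 j b)"
  and hecke_prod_tensor: "hecke_prod (hecke_T scale (k + l)) k j (tensor scale k h b)
    = tensor scale k h (hecke_prod (hecke_T (*) l) 0 j b)"
proof -
  note * = hecke_intertwine[where E = UNIV and \<phi> = "tensor scale k h" and c = 0 and d = k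
      and T = "hecke_T (*) l" and T' = "hecke_T scale (k + l)" and j = 0 and x = b and k = j]
  show "hecke_sum (hecke_T scale (k + l)) k j (tensor scale k h b)
    = tensor scale k h (hecke_sum (hecke_T (*) l) 0 j b)"
    using *(2) by (simp add: tensor_add_right hecke_T_tensor[symmetric] add.commute tensor_zero_right)
  show "hecke_prod (hecke_T scale (k + l)) k j (tensor scale k h b)
    = tensor scale k h (hecke_prod (hecke_T (*) l) 0 j b)"
    using *(1) by (simp add: tensor_add_right hecke_T_tensor[symmetric] add.commute tensor_zero_right)
qed

end

section \<open>Antisymmetric tensors\<close>

definition alternating :: "nat \<Rightarrow> nat \<Rightarrow> (nat list \<Rightarrow> 'a::ab_group_add) \<Rightarrow> bool" where
  "alternating n k f \<longleftrightarrow> (\<forall>w i. length w = n \<longrightarrow> Suc i < k \<longrightarrow> f (swap_adj i w) = - f w)"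

lemma alternatingD:
  "alternating n k f \<Longrightarrow> length w = n \<Longrightarrow> Suc i < k \<Longrightarrow> f (swap_adj i w) = - f w"
  by (simp add: alternating_def)

text \<open>A transposition of distant positions is a conjugate \<open>(a b) (b c) (a b)\<close> of
  closer ones, and three sign changes amount to one.\<close>

lemma alternating_transpose:
  assumes "alternating n n f" and "a < b" and "b < n" and "length w = n"
  shows "f (permute_list (transpose a b) w) = - f w"
  using assms(2-4)
proof (induction arbitrary: w rule: less_Suc_induct)
  case (1 a)
  then show ?case
    using alternatingD[OF assms(1), of w a] by (simp add: swap_adj_eq_permute_list)
next
  case (2 a b c)
  have perm: "transpose a b permutes {..<n}" "transpose b c permutes {..<n}"
    using 2 by (auto intro!: permutes_swap_id)
  have "permute_list (transpose a c) w
      = permute_list (transpose a b \<circ> transpose b c \<circ> transpose a b) w"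
    using 2 by (simp add: transpose_comp_triple)
  also have "\<dots> = permute_list (transpose a b) (permute_list (transpose b c)
      (permute_list (transpose a b) w))"
    using 2(6) perm by (simp add: permute_list_compose)
  finally show ?case
    using 2 by simp
qed

lemma bracket_apply:
  "bracket w u = (\<Sum>\<tau> | \<tau> permutes {..<length w}. if u = permute_list \<tau> w then of_int (sign \<tau>) else 0)"
  unfolding bracket_def sum_fun_app by (intro sum.cong) (auto simp: pw_def basis_tensor_def)

lemma bracket_in_tensor_space:
  assumes "w \<in> words m k"
  shows "bracket w \<in> tensor_space m k"
proof -
  have w: "length w = k"
    using assms by (simp add: words_def)
  have "bracket w u = 0" if "u \<notin> words m k" for u
    unfolding bracket_apply w
  proof (intro sum.neutral ballI)
    fix \<tau> assume "\<tau> \<in> {\<tau>. \<tau> permutes {..<k}}"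
    then have "permute_list \<tau> w \<in> words m k"
      using assms w by (simp add: words_def)
    then show "(if u = permute_list \<tau> w then of_int (sign \<tau>) else 0) = (0 :: K)"
      using that by auto
  qed
  then show ?thesis
    by (simp add: tensor_space_def)
qed

lemma alternating_bracket:
  assumes "length w = k"
  shows "alternating k k (bracket w)"
  unfolding alternating_def
proof (intro allI impI)
  fix u :: "nat list" and i assume u: "length u = k" and i: "Suc i < k"
  define t where "t = transpose i (Suc i)"
  have t: "t permutes {..<k}"
    using i unfolding t_def by (intro permutes_swap_id) auto
  have tt: "permute_list t (permute_list t v) = v" if "length v = k" for v :: "nat list"
    using permute_list_compose[of t v t] t that by (simp add: t_def)
  have "bracket w (swap_adj i u)
      = (\<Sum>\<tau> | \<tau> permutes {..<k}. if permute_list t u = permute_list \<tau> w then of_int (sign \<tau>) else 0)"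
    using u i assms by (simp add: bracket_apply swap_adj_eq_permute_list t_def)
  \<comment> \<open>Replacing \<open>\<tau>\<close> by \<open>\<tau> \<circ> t\<close> moves the
    transposition to the other side of the equation and flips the sign.\<close>
  also have "\<dots> = (\<Sum>\<tau> | \<tau> permutes {..<k}. if u = permute_list \<tau> w then - of_int (sign \<tau>) else 0)"
  proof (rule sum.reindex_bij_witness[of _ "\<lambda>\<tau>. \<tau> \<circ> t" "\<lambda>\<tau>. \<tau> \<circ> t"])
    fix \<tau> assume "\<tau> \<in> {\<tau>. \<tau> permutes {..<k}}"
    then have \<tau>: "\<tau> permutes {..<k}" by simp
    show "\<tau> \<circ> t \<circ> t = \<tau>" "\<tau> \<circ> t \<circ> t = \<tau>"
      by (simp_all add: t_def comp_assoc)
    show "\<tau> \<circ> t \<in> {\<tau>. \<tau> permutes {..<k}}" "\<tau> \<circ> t \<in> {\<tau>. \<tau> permutes {..<k}}"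
      using \<tau> t by (simp_all add: permutes_compose)
    have "sign (\<tau> \<circ> t) = - sign \<tau>"
      using \<tau> t by (subst sign_compose) (auto simp: permutation_permutes t_def sign_swap_id)
    moreover have "permute_list (\<tau> \<circ> t) w = permute_list t (permute_list \<tau> w)"
      using t assms by (simp add: permute_list_compose)
    moreover have "permute_list t u = permute_list \<tau> w \<longleftrightarrow> u = permute_list t (permute_list \<tau> w)"
      using tt[of u] tt[of "permute_list \<tau> w"] u assms by auto
    ultimately show "(if u = permute_list (\<tau> \<circ> t) w then - of_int (sign (\<tau> \<circ> t)) else 0)
        = (if permute_list t u = permute_list \<tau> w then of_int (sign \<tau>) else (0::K))"
      by simp
  qed
  also have "\<dots> = - bracket w u"
    by (simp add: bracket_apply assms if_distrib[of uminus] flip: sum_negf cong: if_cong)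
  finally show "bracket w (swap_adj i u) = - bracket w u" .
qed

context tensor_module
begin

lemma double_eq_0: "x = - x \<Longrightarrow> x = 0" for x :: 'a
proof -
  assume "x = - x"
  then have "x + x = 0" by (metis add.right_inverse)
  then have "scale (1 + 1) x = 0"
    by (simp only: scale_left_distrib scale_one)
  moreover have "(1 + 1 :: K) \<noteq> 0"
    using fact_K_nonzero[of 2] by (simp add: fact_2)
  ultimately show "x = 0"
    using scale_eq_0_iff by blast
qed

text \<open>Although the operators depend on \<open>q\<close>, these eigenvectors do not. Compared
  at a word with distinct letters in the two positions, the eigenvalue equation says that
  \<open>f\<close> changes sign. At equal letters it says \<open>(1 + q) f w = 0\<close>, hence
  \<open>f w = 0\<close>, which is also what the sign change says there.\<close>

lemma q_invariant_iff_alternating: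
  assumes "f \<in> tensor_space m n" and "k \<le> n"
  shows "H.q_invariant n k f \<longleftrightarrow> alternating n k f"
proof
  assume inv: "H.q_invariant n k f"
  show "alternating n k f"
    unfolding alternating_def
  proof (intro allI impI)
    fix w :: "nat list" and i assume w: "length w = n" and i: "Suc i < k"
    have eq: "hecke_T scale n i f w = scale qK (f w)"
      using inv i by (simp add: H.q_invariant_def pw_def)
    show "f (swap_adj i w) = - f w"
    proof (cases "w ! i" "w ! Suc i" rule: linorder_cases)
      case less
      then show ?thesis
        using eq w i assms(2) by (simp add: hecke_T_def scale_left_diff_distrib)
    next
      case equal
      then have "- f w = scale qK (f w)"
        using eq w i assms(2) by (simp add: hecke_T_def)
      then have "scale (qint qK 2) (f w) = 0"
        by (simp add: qint_def numeral_2_eq_2 scale_left_distrib flip: \<open>- f w = _\<close>)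
      then have "f w = 0"
        using qint_qK_nonzero[of 2] by (simp only: scale_eq_0_iff) simp
      moreover have "swap_adj i w = w"
        using equal by (simp add: swap_adj_def) (metis list_update_id)
      ultimately show ?thesis by simp
    next
      case greater
      then have "scale qK (f (swap_adj i w)) = scale qK (- f w)"
        using eq w i assms(2) by (simp add: hecke_T_def scale_minus_right minus_equation_iff)
      then show ?thesis
        using qK_nonzero scale_left_imp_eq by blast
    qed
  qed
next
  assume alt: "alternating n k f"
  show "H.q_invariant n k f"
    unfolding H.q_invariant_def
  proof (intro allI impI ext)
    fix i w assume i: "Suc i < k"
    show "hecke_T scale n i f w = pw scale qK f w"
    proof (cases "length w = n")
      case False
      then have "f w = 0"
        using assms(1) by (auto simp: tensor_space_def words_def)
      then show ?thesis
        using False by (simp add: hecke_T_trivial pw_def)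
    next
      case True
      have sw: "f (swap_adj i w) = - f w"
        using alternatingD[OF alt True i] .
      show ?thesis
      proof (cases "w ! i" "w ! Suc i" rule: linorder_cases)
        case equal
        then have "swap_adj i w = w"
          by (simp add: swap_adj_def) (metis list_update_id)
        then have "f w = 0"
          using sw double_eq_0 by simp
        then show ?thesis
          using sw by (simp add: hecke_T_def pw_def)
      qed (use sw True i assms(2) in \<open>auto simp: hecke_T_def pw_def scale_left_diff_distrib\<close>)
    qed
  qed
qed

lemma alternating_permute:
  assumes "alternating n n f" and "\<tau> permutes {..<n}" and "length w = n"
  shows "f (permute_list \<tau> w) = scale (of_int (sign \<tau>)) (f w)"
  using assms(2) finite_lessThan assms(3)
proof (induction arbitrary: w rule: permutes_induct)
  case id
  then show ?case by simp
next
  case (swap a b p)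
  have "f (permute_list (transpose a b) w) = - f w"
    using alternating_transpose[OF assms(1), of a b w] alternating_transpose[OF assms(1), of b a w] swap
    by (cases a b rule: linorder_cases) (auto simp: transpose_commute)
  moreover have "sign (transpose a b \<circ> p) = - sign p"
    using swap permutes_imp_permutation[OF finite_lessThan, of p n]
    by (simp add: sign_compose permutation_swap_id sign_swap_id)
  moreover have "permute_list (transpose a b \<circ> p) w = permute_list p (permute_list (transpose a b) w)"
    using swap by (simp add: permute_list_compose)
  moreover have "f (permute_list p (permute_list (transpose a b) w))
      = scale (of_int (sign p)) (f (permute_list (transpose a b) w))"
    using swap by simp
  ultimately show ?case
    by (simp only: of_int_minus scale_minus_left scale_minus_right)
qed

text \<open>In the coefficient of \<open>u\<close>, each permutation contributes through exactly one
  word \<open>w\<close>. The sign in the bracket cancels the sign relating \<open>f w\<close> to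
  \<open>f u\<close>, which leaves \<open>f u\<close> once for each of the \<open>n!\<close>
  permutations.\<close>

lemma sum_bracket:
  assumes "f \<in> tensor_space m n" and "alternating n n f"
  shows "(\<Sum>w\<in>words m n. pure_tensor scale (f w) (bracket w)) = pw scale (of_nat (fact n)) f"
proof
  fix u
  show "(\<Sum>w\<in>words m n. pure_tensor scale (f w) (bracket w)) u = pw scale (of_nat (fact n)) f u"
  proof (cases "u \<in> words m n")
    case False
    then have "f u = 0" "bracket w u = 0" if "w \<in> words m n" for w
      using assms(1) bracket_in_tensor_space[OF that] by (auto simp: tensor_space_def)
    moreover have "f u = 0"
      using assms(1) False by (auto simp: tensor_space_def)
    ultimately show ?thesis
      by (simp add: sum_fun_app pure_tensor_def pw_def)
  next
    case True
    then have u: "length u = n"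
      by (simp add: words_def)
    have "(\<Sum>w\<in>words m n. pure_tensor scale (f w) (bracket w)) u
        = (\<Sum>w\<in>words m n. \<Sum>\<tau> | \<tau> permutes {..<n}. if u = permute_list \<tau> w then f u else 0)"
    proof (unfold sum_fun_app, intro sum.cong refl)
      fix w assume "w \<in> words m n"
      then have w: "length w = n"
        by (simp add: words_def)
      have "pure_tensor scale (f w) (bracket w) u
          = (\<Sum>\<tau> | \<tau> permutes {..<n}. scale (if u = permute_list \<tau> w then of_int (sign \<tau>) else 0) (f w))"
        by (simp add: pure_tensor_def bracket_apply w scale_sum_left)
      also have "\<dots> = (\<Sum>\<tau> | \<tau> permutes {..<n}. if u = permute_list \<tau> w then f u else 0)"
        using alternating_permute[OF assms(2) _ w] by (intro sum.cong) auto
      finally show "pure_tensor scale (f w) (bracket w) u = \<dots>" .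
    qed
    also have "\<dots> = (\<Sum>\<tau> | \<tau> permutes {..<n}. \<Sum>w\<in>words m n. if u = permute_list \<tau> w then f u else 0)"
      by (rule sum.swap)
    also have "\<dots> = (\<Sum>\<tau> | \<tau> permutes {..<n}. f u)"
    proof (intro sum.cong refl)
      fix \<tau> assume "\<tau> \<in> {\<tau>. \<tau> permutes {..<n}}"
      then have \<tau>: "\<tau> permutes {..<n}" by simp
      then have inv: "inv \<tau> permutes {..<n}"
        by (rule permutes_inv)
      have iff: "u = permute_list \<tau> w \<longleftrightarrow> w = permute_list (inv \<tau>) u" if "w \<in> words m n" for w
      proof -
        have w: "length w = n"
          using that by (simp add: words_def)
        have "permute_list (inv \<tau>) (permute_list \<tau> w) = w"
          "permute_list \<tau> (permute_list (inv \<tau>) u) = u"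
          using permute_list_compose[of "inv \<tau>" w \<tau>] permute_list_compose[of \<tau> u "inv \<tau>"] \<tau> inv u w
          by (simp_all add: permutes_inv_o)
        then show ?thesis by auto
      qed
      have "(\<Sum>w\<in>words m n. if u = permute_list \<tau> w then f u else 0)
          = (\<Sum>w\<in>words m n. if w = permute_list (inv \<tau>) u then f u else 0)"
        by (intro sum.cong) (auto simp: iff)
      also have "\<dots> = f u"
        using True inv u by (simp add: finite_words) (simp add: words_def)
      finally show "(\<Sum>w\<in>words m n. if u = permute_list \<tau> w then f u else 0) = f u" .
    qed
    also have "\<dots> = scale (of_nat (fact n)) (f u)"
      using card_permutations[of "{..<n}" n] by (simp del: of_nat_fact add: sum_constant_scale)
    finally show ?thesis
      by (simp add: pw_def)
  qed
qed

text \<open>Brackets are alternating, and conversely \<open>sum_bracket\<close> can be divided by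
  \<open>n!\<close> in characteristic zero.\<close>

lemma Cf_eq: "Cf m scale n = {f \<in> tensor_space m n. alternating n n f}"
proof -
  have antisym_subset: "antisym m n \<subseteq> {b \<in> tensor_space m n. alternating n n b}"
    unfolding antisym_def
  proof (rule K.P.span_minimal)
    show "bracket ` words m n \<subseteq> {b \<in> tensor_space m n. alternating n n b}"
      using bracket_in_tensor_space alternating_bracket by (auto simp: words_def)
    show "K.P.subspace {b \<in> tensor_space m n. alternating n n b}"
      by (auto simp: K.P.subspace_def tensor_space_def alternating_def pw_def)
  qed
  show ?thesis
  proof (intro equalityI subsetI)
    fix f assume "f \<in> Cf m scale n"
    then show "f \<in> {f \<in> tensor_space m n. alternating n n f}"
      unfolding Cf_def coeff_tensor_sub_def
    proof (rule P.span_induct_alt)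
      show "0 \<in> {f \<in> tensor_space m n. alternating n n f}"
        by (simp add: tensor_space_zero alternating_def)
    next
      fix c and g h :: "nat list \<Rightarrow> 'a" assume "g \<in> {pure_tensor scale x b |x b. b \<in> antisym m n}"
        and h: "h \<in> {f \<in> tensor_space m n. alternating n n f}"
      then obtain x b where "g = pure_tensor scale x b" "b \<in> tensor_space m n" "alternating n n b"
        using antisym_subset by blast
      then show "pw scale c g + h \<in> {f \<in> tensor_space m n. alternating n n f}"
        using h by (auto simp: tensor_space_def alternating_def pure_tensor_def pw_def)
    qed
  next
    fix f :: "nat list \<Rightarrow> 'a" assume "f \<in> {f \<in> tensor_space m n. alternating n n f}"
    then have "(\<Sum>w\<in>words m n. pure_tensor scale (f w) (bracket w)) = pw scale (of_nat (fact n)) f"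
      by (intro sum_bracket) auto
    then have "f = pw scale (inverse (of_nat (fact n)))
        (\<Sum>w\<in>words m n. pure_tensor scale (f w) (bracket w))"
      using fact_K_nonzero[of n] by (simp del: of_nat_fact)
    moreover have "\<dots> \<in> Cf m scale n"
      unfolding Cf_def coeff_tensor_sub_def antisym_def
      by (intro P.span_scale P.span_sum P.span_base) (blast intro: K.P.span_base)
    ultimately show "f \<in> Cf m scale n" by simp
  qed
qed

lemma subspace_Cf: "P.subspace (Cf m scale n)"
  unfolding Cf_def coeff_tensor_sub_def by (rule P.subspace_span)

section \<open>The summands as eigenspaces of \<sigma>\<close>

lemma tensor_expansion:
  assumes "f \<in> tensor_space m (k + l)"
  shows "f = (\<Sum>u\<in>words m l. tensor scale k (slice k u f) (basis_tensor u))"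
proof
  fix w
  have "(\<Sum>u\<in>words m l. tensor scale k (slice k u f) (basis_tensor u)) w
      = (\<Sum>u\<in>words m l. if u = drop k w then slice k u f (take k w) else 0)"
    unfolding sum_fun_app by (intro sum.cong) (auto simp: tensor_def basis_tensor_def)
  also have "\<dots> = (if drop k w \<in> words m l then slice k (drop k w) f (take k w) else 0)"
    by (simp add: finite_words)
  also have "\<dots> = f w"
  proof (cases "w \<in> words m (k + l)")
    case True
    then show ?thesis
      by (auto simp: words_def slice_def dest: in_set_dropD)
  next
    case False
    then have "f w = 0"
      using assms by (simp add: tensor_space_def)
    then show ?thesis by (simp add: slice_def)
  qed
  finally show "f w = (\<Sum>u\<in>words m l. tensor scale k (slice k u f) (basis_tensor u)) w" ..
qed

lemma slice_in_Cf:
  assumes "f \<in> tensor_space m (k + l)" and "alternating (k + l) k f"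
  shows "slice k u f \<in> Cf m scale k"
proof -
  have "slice k u f w = 0" if "w \<notin> words m k" for w
    using assms(1) that by (auto simp: slice_def tensor_space_def words_def)
  moreover have "slice k u f (swap_adj i w) = - slice k u f w" if w: "length w = k" and i: "Suc i < k" for i w
  proof (cases "length u = l")
    case True
    have "swap_adj i w @ u = swap_adj i (w @ u)"
      using w i by (simp add: swap_adj_def list_update_append nth_append)
    then show ?thesis
      using w True i alternatingD[OF assms(2)] by (simp add: slice_def)
  next
    case False
    then show ?thesis
      using w assms(1) by (auto simp: slice_def tensor_space_def words_def)
  qed
  ultimately show ?thesis
    by (simp add: Cf_eq tensor_space_def alternating_def)
qed

lemma tensor_in_tensor_space:
  assumes "f \<in> tensor_space m k" and "b \<in> tensor_space m l"
  shows "tensor scale k f b \<in> tensor_space m (k + l)"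
  unfolding tensor_space_def
proof (intro CollectI allI impI)
  fix w assume w: "w \<notin> words m (k + l)"
  have "set w = set (take k w) \<union> set (drop k w)"
    by (metis append_take_drop_id set_append)
  then have "take k w \<notin> words m k \<or> drop k w \<notin> words m l"
    using w by (auto simp: words_def)
  then show "tensor scale k f b w = 0"
    using assms by (auto simp: tensor_def tensor_space_def)
qed

lemma shifted_prod_tensor:
  "shifted_prod (pw scale) (hecke_sum (hecke_T scale (k + l)) k l) cs (tensor scale k h b)
    = tensor scale k h (shifted_prod (pw (*)) (hecke_sum (hecke_T (*) l) 0 l) cs b)"
proof (induction cs arbitrary: b)
  case (Cons c cs)
  have "tensor scale k h b - tensor scale k h b' = tensor scale k h (b - b')" for b b'
    by (simp add: tensor_def fun_eq_iff scale_left_diff_distrib)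
  then show ?case
    by (simp only: shifted_prod.simps hecke_sum_tensor Cons.IH flip: tensor_scale_right)
qed simp

text \<open>The product over the roots \<open>[0], ..., [l]\<close> vanishes by
  \<open>eigen_prod_Suc_n\<close>, and the factor of the root \<open>[0] = 0\<close> is \<sigma>
  itself.\<close>

lemma shifted_prod_in_ker_sigma:
  assumes "b \<in> tensor_space m l"
  shows "shifted_prod (pw (*)) (hecke_sum (hecke_T (*) l) 0 l) (map (qint qK) [1..<Suc l]) b
    \<in> ker_sigma m l"
proof -
  have "[0..<Suc l] = 0 # [1..<Suc l]"
    by (simp add: upt_conv_Cons del: upt_Suc)
  then have "hecke_sum (hecke_T (*) l) 0 l
      (shifted_prod (pw (*)) (hecke_sum (hecke_T (*) l) 0 l) (map (qint qK) [1..<Suc l]) b) = 0"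
    using K.H.eigen_prod_Suc_n[of l b] by (simp only: list.map K.H.S.P_Cons) simp
  moreover have "shifted_prod (pw (*)) (hecke_sum (hecke_T (*) l) 0 l) cs b \<in> tensor_space m l" for cs
    using assms
  proof (induction cs arbitrary: b)
    case (Cons c cs)
    have "hecke_sum (hecke_T (*) l) 0 l b - pw (*) c b \<in> tensor_space m l"
      by (intro K.P.subspace_diff K.P.subspace_scale K.hecke_sum_in_tensor_space
          subspace_tensor_space vector_space_K Cons.prems)
    then show ?case
      by (simp only: shifted_prod.simps Cons.IH)
  qed simp
  ultimately show ?thesis
    by (simp add: ker_sigma_eq)
qed

text \<open>For the inclusion from right to left, the polynomial \<open>\<Prod>\<^sub>j (\<sigma> - [j])\<close> over \<open>1 \<le> j \<le> l\<close> acts on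
  the kernel of \<open>\<sigma>\<close> as a nonzero scalar and maps all of \<open>V\<^sup>\<otimes>\<^sup>l\<close> into \<open>ker \<sigma>\<^sub>l\<close>.\<close>

lemma summand_eq:
  "summand m scale k l = {f \<in> tensor_space m (k + l).
     H.q_invariant (k + l) k f \<and> hecke_sum (hecke_T scale (k + l)) k l f = 0}" (is "_ = ?X")
proof (intro equalityI subsetI)
  fix f assume "f \<in> summand m scale k l"
  then show "f \<in> ?X"
    unfolding summand_def tensor_sub_def
  proof (rule P.span_induct_alt)
    show "0 \<in> ?X"
      by (simp add: tensor_space_zero H.q_invariant_def H.T_zero H.S.zero)
  next
    fix c and g h :: "nat list \<Rightarrow> 'a"
    assume "g \<in> {tensor scale k f b |f b. f \<in> Cf m scale k \<and> b \<in> ker_sigma m l}" and h: "h \<in> ?X"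
    then obtain f b where g: "g = tensor scale k f b" and f: "f \<in> tensor_space m k" "alternating k k f"
      and b: "b \<in> tensor_space m l" "hecke_sum (hecke_T (*) l) 0 l b = 0"
      by (auto simp: Cf_eq ker_sigma_eq)
    have gt: "g \<in> tensor_space m (k + l)"
      unfolding g using f b by (intro tensor_in_tensor_space)
    have "alternating (k + l) k g"
      unfolding alternating_def
    proof (intro allI impI)
      fix w :: "nat list" and i assume w: "length w = k + l" and i: "Suc i < k"
      then have "take k (swap_adj i w) = swap_adj i (take k w)" "drop k (swap_adj i w) = drop k w"
        by (simp_all add: swap_adj_def take_update_swap)
      then show "g (swap_adj i w) = - g w"
        using alternatingD[OF f(2), of "take k w" i] w i
        by (simp add: g tensor_def scale_minus_right)
    qed
    then have "H.q_invariant (k + l) k g"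
      using gt q_invariant_iff_alternating by simp
    then have "H.q_invariant (k + l) k (pw scale c g + h)"
      using h by (simp add: H.q_invariant_def H.T_add H.T_scale P.scale_right_distrib mult.commute)
    moreover have "hecke_sum (hecke_T scale (k + l)) k l g = 0"
      unfolding g hecke_sum_tensor b(2) by (rule tensor_zero_right)
    ultimately show "pw scale c g + h \<in> ?X"
      using h gt subspace_tensor_space[OF vector_space_axioms]
      by (simp add: H.hecke_sum_linear P.subspace_add P.subspace_scale)
  qed
next
  fix f assume "f \<in> ?X"
  \<comment> \<open>The kernel condition is kept as an eigenvalue equation for 0, the form that
    \<open>P_eigenvector\<close> takes; \<open>c\<close> below is the value of the polynomial at
    0.\<close>
  then have ft: "f \<in> tensor_space m (k + l)" and inv: "H.q_invariant (k + l) k f"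
    and ker: "hecke_sum (hecke_T scale (k + l)) k l f = pw scale 0 f"
    by auto
  have alt: "alternating (k + l) k f"
    using inv ft q_invariant_iff_alternating by simp
  define cs where "cs = map (qint qK) [1..<Suc l]"
  define c where "c = (\<Prod>c\<leftarrow>cs. 0 - c)"
  have "qint qK j \<noteq> 0" if "j \<in> set [1..<Suc l]" for j
    using that by (intro qint_qK_nonzero) auto
  then have "c \<noteq> 0"
    unfolding c_def cs_def by (fastforce simp: prod_list_zero_iff simp del: upt_Suc)
  have "pw scale c f = shifted_prod (pw scale) (hecke_sum (hecke_T scale (k + l)) k l) cs f"
    unfolding c_def using H.S.P_eigenvector[OF ker] ..
  \<comment> \<open>The polynomial affects only the last \<open>l\<close> factors, so it can be
    applied to the right factors of the expansion. The left factors are slices of \<open>f\<close>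
    and inherit its antisymmetry.\<close>
  also have "\<dots> = shifted_prod (pw scale) (hecke_sum (hecke_T scale (k + l)) k l) cs
      (\<Sum>u\<in>words m l. tensor scale k (slice k u f) (basis_tensor u))"
    using tensor_expansion[OF ft] by simp
  also have "\<dots> = (\<Sum>u\<in>words m l. tensor scale k (slice k u f)
      (shifted_prod (pw (*)) (hecke_sum (hecke_T (*) l) 0 l) cs (basis_tensor u)))"
    by (simp add: H.S.P_sum shifted_prod_tensor)
  also have "\<dots> \<in> summand m scale k l"
    unfolding summand_def tensor_sub_def cs_def
    using slice_in_Cf[OF ft alt] shifted_prod_in_ker_sigma[OF basis_tensor_in]
    by (intro P.span_sum P.span_base) blast
  finally have "pw scale (inverse c) (pw scale c f) \<in> summand m scale k l"
    unfolding summand_def tensor_sub_def by (rule P.span_scale)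
  then show "f \<in> summand m scale k l"
    using \<open>c \<noteq> 0\<close> by simp
qed

lemma subspace_summand: "P.subspace (summand m scale k l)"
  unfolding summand_def tensor_sub_def by (rule P.subspace_span)

lemma summand_eq_eigenspace:
  assumes "k \<le> n"
  shows "summand m scale k (n - k)
    = {f \<in> tensor_space m n. hecke_sum (hecke_T scale n) 0 n f = pw scale (qint qK k) f}"
  using assms by (auto simp: summand_eq H.eigenvector_iff)

text \<open>The eigenvalues \<open>[0], ..., [n]\<close> are distinct. The polynomial identity
  \<open>eigen_prod_Suc_n\<close> yields the components, and the independence of eigenvectors makes
  them unique.\<close>

lemma internal_direct_sum_summand:
  "internal_direct_sum (pw scale) (tensor_space m n) {0..n} (\<lambda>k. summand m scale k (n - k))"
proof -
  have inj: "inj_on (qint qK) {..<Suc n}"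
    using inj_qint[OF qK_nonzero qint_qK_nonzero] inj_on_subset by blast
  have I: "{0..n} = {..<Suc n}" by auto
  have "\<exists>!g. g \<in> (\<Pi>\<^sub>E k\<in>{0..n}. summand m scale k (n - k)) \<and> f = (\<Sum>k\<in>{0..n}. g k)"
    if f: "f \<in> tensor_space m n" for f
  proof (rule ex_ex1I)
    obtain g where g: "\<And>j. j < Suc n \<Longrightarrow> g j \<in> tensor_space m n \<and>
        hecke_sum (hecke_T scale n) 0 n (g j) = pw scale (qint qK j) (g j)"
      and sum: "f = (\<Sum>j<Suc n. g j)"
      using H.S.eigenvector_decomposition[OF subspace_tensor_space[OF vector_space_axioms] _ inj f
          H.eigen_prod_Suc_n] hecke_sum_in_tensor_space by meson
    then have "restrict g {0..n} \<in> (\<Pi>\<^sub>E k\<in>{0..n}. summand m scale k (n - k)) \<and>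
        f = (\<Sum>k\<in>{0..n}. restrict g {0..n} k)"
      by (auto simp: summand_eq_eigenspace I simp del: sum.lessThan_Suc)
    then show "\<exists>g. g \<in> (\<Pi>\<^sub>E k\<in>{0..n}. summand m scale k (n - k)) \<and> f = (\<Sum>k\<in>{0..n}. g k)"
      by blast
  next
    fix g h
    assume g: "g \<in> (\<Pi>\<^sub>E k\<in>{0..n}. summand m scale k (n - k)) \<and> f = (\<Sum>k\<in>{0..n}. g k)"
      and h: "h \<in> (\<Pi>\<^sub>E k\<in>{0..n}. summand m scale k (n - k)) \<and> f = (\<Sum>k\<in>{0..n}. h k)"
    have "g k - h k \<in> summand m scale k (n - k)" if "k \<le> n" for k
      using g h that by (intro P.subspace_diff subspace_summand) (auto simp: PiE_def Pi_def)
    then have "hecke_sum (hecke_T scale n) 0 n (g k - h k) = pw scale (qint qK k) (g k - h k)"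
      if "k < Suc n" for k
      using that by (simp add: summand_eq_eigenspace)
    moreover have "(\<Sum>k<Suc n. g k - h k) = 0"
      using g h unfolding I sum_subtractf by simp
    ultimately have "g k - h k = 0" if "k < Suc n" for k
      using that H.S.eigenvectors_independent[OF inj, of n 0 n "\<lambda>k. g k - h k" k] by blast
    then show "g = h"
      using g h by (intro PiE_ext[of g "{0..n}" _ h]) auto
  qed
  moreover have "summand m scale k (n - k) \<subseteq> tensor_space m n" if "k \<le> n" for k
    using that by (auto simp: summand_eq_eigenspace)
  ultimately show ?thesis
    using subspace_summand by (simp add: internal_direct_sum_def)
qed

end

section \<open>The differential\<close>

locale yang_baxter_module = tensor_module scale
  for scale :: "K \<Rightarrow> 'a::ab_group_add \<Rightarrow> 'a" +
  fixes m :: nat and RM :: "(nat list \<Rightarrow> 'a) \<Rightarrow> 'a"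
  assumes V_module: "V_module m scale RM"
begin

abbreviation "act \<equiv> act_tensor_id RM"
abbreviation "\<sigma> n \<equiv> hecke_sum (hecke_T scale n) 0 n"

lemma RM_add: "f \<in> tensor_space m (Suc 0) \<Longrightarrow> g \<in> tensor_space m (Suc 0) \<Longrightarrow> RM (f + g) = RM f + RM g"
  and RM_scale: "f \<in> tensor_space m (Suc 0) \<Longrightarrow> RM (pw scale c f) = scale c (RM f)"
  and wall: "f \<in> tensor_space m 2 \<Longrightarrow> RM (act f) = RM (act (id_tensor_map scale m 2 (R_op m) f))"
  using V_module by (auto simp: V_module_def linear_on_def)

lemma RM_zero: "RM 0 = 0"
  using RM_scale[of 0 0] by (simp add: tensor_space_zero)

lemma slice_in_tensor_space: "f \<in> tensor_space m (k + l) \<Longrightarrow> slice k u f \<in> tensor_space m k"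
  for f :: "nat list \<Rightarrow> 'a"
  by (auto simp: slice_def tensor_space_def words_def)

lemma slice_1_in_tensor_space: "f \<in> tensor_space m (Suc n) \<Longrightarrow> slice (Suc 0) u f \<in> tensor_space m (Suc 0)"
  for f :: "nat list \<Rightarrow> 'a"
  using slice_in_tensor_space[of f "Suc 0" n u] by simp

lemma act_apply: "act f w = RM (slice (Suc 0) w f)"
  by (simp add: act_tensor_id_def)

lemma slice_add: "slice k u (f + g) = slice k u f + slice k u g"
  and slice_scale: "slice k u (pw scale c f) = pw scale c (slice k u f)"
  and slice_zero: "slice k u 0 = 0"
  for f g :: "nat list \<Rightarrow> 'a"
  by (auto simp: slice_def pw_def)

lemma act_add:
  "f \<in> tensor_space m (Suc n) \<Longrightarrow> g \<in> tensor_space m (Suc n) \<Longrightarrow> act (f + g) = act f + act g"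
  by (rule ext) (simp only: act_apply plus_fun_apply slice_add
      RM_add[OF slice_1_in_tensor_space slice_1_in_tensor_space])

lemma act_scale: "f \<in> tensor_space m (Suc n) \<Longrightarrow> act (pw scale c f) = pw scale c (act f)"
  by (rule ext) (simp only: act_apply slice_scale RM_scale[OF slice_1_in_tensor_space] pw_def[of _ _ "act f"])

lemma act_zero: "act 0 = 0"
  by (simp add: act_apply slice_zero RM_zero fun_eq_iff)

lemma act_sum:
  assumes "\<And>i. i \<in> I \<Longrightarrow> f i \<in> tensor_space m (Suc n)"
  shows "act (\<Sum>i\<in>I. f i) = (\<Sum>i\<in>I. act (f i))"
  using assms
proof (induction I rule: infinite_finite_induct)
  case (insert i I)
  then have "(\<Sum>i\<in>I. f i) \<in> tensor_space m (Suc n)"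
    by (intro P.subspace_sum subspace_tensor_space vector_space_axioms) auto
  then have "act (f i + (\<Sum>i\<in>I. f i)) = act (f i) + act (\<Sum>i\<in>I. f i)"
    using insert.prems by (intro act_add[of _ n]) auto
  moreover have "act (\<Sum>i\<in>I. f i) = (\<Sum>i\<in>I. act (f i))"
    using insert by simp
  ultimately show ?case
    by (simp only: sum.insert[OF insert.hyps])
qed (simp_all add: act_zero)

lemma act_in_tensor_space:
  assumes "f \<in> tensor_space m (Suc n)"
  shows "act f \<in> tensor_space m n"
  unfolding tensor_space_def
proof (intro CollectI allI impI)
  fix w assume "w \<notin> words m n"
  then have "slice (Suc 0) w f = 0"
    using assms by (auto simp: slice_def tensor_space_def words_def fun_eq_iff)
  then show "act f w = 0"
    by (simp add: act_apply RM_zero)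
qed

lemma swap_adj_Cons: "swap_adj (Suc i) (a # w) = a # swap_adj i w"
  by (simp add: swap_adj_def)

text \<open>The operator does not touch the first factor, so each slice of its value is a
  combination of slices of \<open>f\<close>, and \<open>RM\<close> is linear. The index drops
  because the first factor is absorbed into the module.\<close>

lemma act_hecke_T:
  assumes "f \<in> tensor_space m (Suc n)"
  shows "act (hecke_T scale (Suc n) (Suc j) f) = hecke_T scale n j (act f)"
proof
  fix w :: "nat list"
  note slice = slice_1_in_tensor_space[OF assms]
  have sub: "P.subspace (tensor_space m (Suc 0))"
    by (intro subspace_tensor_space vector_space_axioms)
  have RM_uminus: "RM (- g) = - RM g" if "g \<in> tensor_space m (Suc 0)" for g
    using RM_scale[OF that, of "-1"] by simp
  have RM_diff: "RM (g - h) = RM g - RM h"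
    if "g \<in> tensor_space m (Suc 0)" "h \<in> tensor_space m (Suc 0)" for g h
    using RM_add[OF that(1) P.subspace_neg[OF sub that(2)]] RM_uminus[OF that(2)] by simp
  have pt: "slice (Suc 0) w (hecke_T scale (Suc n) (Suc j) f) u =
     (if length w = n \<and> Suc j < n then
        if w ! j < w ! Suc j then scale (qK - 1) (slice (Suc 0) w f u) - slice (Suc 0) (swap_adj j w) f u
        else if w ! Suc j < w ! j then - scale qK (slice (Suc 0) (swap_adj j w) f u)
        else - slice (Suc 0) w f u
      else - slice (Suc 0) w f u)" for u
  proof (cases "length u = Suc 0")
    case True
    then obtain a where "u = [a]"
      by (auto simp: length_Suc_conv)
    then show ?thesis
      by (simp add: slice_def hecke_T_def swap_adj_Cons)
  qed (simp add: slice_def)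
  have "slice (Suc 0) w (hecke_T scale (Suc n) (Suc j) f) =
     (if length w = n \<and> Suc j < n then
        if w ! j < w ! Suc j then pw scale (qK - 1) (slice (Suc 0) w f) - slice (Suc 0) (swap_adj j w) f
        else if w ! Suc j < w ! j then - pw scale qK (slice (Suc 0) (swap_adj j w) f)
        else - slice (Suc 0) w f
      else - slice (Suc 0) w f)"
    by (rule ext) (simp add: pt pw_def)
  then show "act (hecke_T scale (Suc n) (Suc j) f) w = hecke_T scale n j (act f) w"
    by (simp add: act_apply hecke_T_def RM_diff RM_scale RM_uminus slice sub
        P.subspace_neg P.subspace_scale)
qed

lemma act_hecke_sum:
  assumes "f \<in> tensor_space m (Suc n)"
  shows "act (hecke_sum (hecke_T scale (Suc n)) (Suc j) l f) = hecke_sum (hecke_T scale n) j l (act f)"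
  using hecke_intertwine(2)[where E = "tensor_space m (Suc n)" and \<phi> = act and c = 1 and d = 0
      and T = "hecke_T scale (Suc n)" and T' = "hecke_T scale n" and j = j and x = f and k = l]
  by (simp add: assms tensor_space_zero tensor_space_add act_zero act_add[of _ n] act_hecke_T
      hecke_T_in_tensor_space[OF vector_space_axioms])

text \<open>Fixing all factors but the first two reduces a double action to
  \<open>M \<otimes> V \<otimes> V\<close>, where the wall condition is stated.\<close>

lemma act_act: "act (act f) w = RM (act (slice 2 w f))"
proof -
  have "slice (Suc 0) w (act f) = act (slice 2 w f)"
  proof
    fix u :: "nat list"
    show "slice (Suc 0) w (act f) u = act (slice 2 w f) u"
    proof (cases "length u = Suc 0")
      case True
      then have "slice (Suc 0) u (slice 2 w f) = slice (Suc 0) (u @ w) f"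
        by (simp add: slice_def fun_eq_iff)
      then show ?thesis
        using True by (simp add: act_apply slice_def[of "Suc 0" w "act f"])
    next
      case False
      then have "slice (Suc 0) u (slice 2 w f) = 0"
        by (simp add: slice_def fun_eq_iff)
      then show ?thesis
        using False by (simp add: act_apply slice_def[of "Suc 0" w "act f"] RM_zero)
    qed
  qed
  then show ?thesis
    by (simp only: act_apply[of "act f"])
qed

text \<open>This is the wall condition on slices, with \<open>R\<close> replaced by
  \<open>- T 0\<close>.\<close>

lemma act_act_hecke_T:
  assumes "f \<in> tensor_space m (Suc (Suc n))"
  shows "act (act (hecke_T scale (Suc (Suc n)) 0 f)) = - act (act f)"
proof
  fix w
  have f: "f \<in> tensor_space m (2 + n)"
    using assms by simp
  have slice: "slice 2 w f \<in> tensor_space m 2"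
    by (rule slice_in_tensor_space[OF f])
  have slice_T: "slice 2 w (hecke_T scale (Suc (Suc n)) 0 f) = hecke_T scale 2 0 (slice 2 w f)"
  proof (cases "length w = n")
    case True
    show ?thesis
    proof
      fix u :: "nat list"
      show "slice 2 w (hecke_T scale (Suc (Suc n)) 0 f) u = hecke_T scale 2 0 (slice 2 w f) u"
      proof (cases "length u = 2")
        case True
        then obtain a v where "u = a # v" "length v = Suc 0"
          by (cases u) simp_all
        moreover from this obtain b where "v = [b]"
          by (cases v) simp_all
        ultimately show ?thesis
          using \<open>length w = n\<close> by (simp add: slice_def hecke_T_def swap_adj_def)
      qed (simp add: slice_def hecke_T_trivial)
    qed
  next
    case False
    then have "slice 2 w f = 0" "slice 2 w (hecke_T scale (Suc (Suc n)) 0 f) = 0"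
      using f hecke_T_in_tensor_space[OF vector_space_axioms f]
      by (auto simp: slice_def tensor_space_def words_def fun_eq_iff)
    then show ?thesis by (simp add: H.T_zero)
  qed
  have T: "hecke_T scale 2 0 (slice 2 w f) \<in> tensor_space m 2"
    using hecke_T_in_tensor_space[OF vector_space_axioms slice] .
  have "act (- hecke_T scale 2 0 (slice 2 w f)) = - act (hecke_T scale 2 0 (slice 2 w f))"
    using act_scale[of "hecke_T scale 2 0 (slice 2 w f)" 1 "-1"] T by (simp add: numeral_2_eq_2)
  moreover have "RM (- act (hecke_T scale 2 0 (slice 2 w f))) = - RM (act (hecke_T scale 2 0 (slice 2 w f)))"
    using RM_scale[of "act (hecke_T scale 2 0 (slice 2 w f))" "-1"]
      act_in_tensor_space[of "hecke_T scale 2 0 (slice 2 w f)" 1] T by (simp add: numeral_2_eq_2)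
  ultimately have "RM (act (slice 2 w f)) = - RM (act (hecke_T scale 2 0 (slice 2 w f)))"
    using wall[OF slice] by (simp add: id_tensor_map_R_op[OF vector_space_axioms slice])
  then show "act (act (hecke_T scale (Suc (Suc n)) 0 f)) w = (- act (act f)) w"
    by (simp add: act_act slice_T)
qed

text \<open>In the expansion with a left factor of length 0, that factor is just an element of
  \<open>M\<close>. Then \<open>hecke_prod_tensor\<close> identifies the Hecke operators with
  coefficients in \<open>M\<close> as the identity of \<open>M\<close> tensored with those on
  \<open>V\<^sup>\<otimes>\<^sup>n\<close>.\<close>

lemma id_tensor_map_d_op:
  assumes "f \<in> tensor_space m n" and "i \<in> {1..n}"
  shows "id_tensor_map scale m n (d_op m i) f
    = pw scale ((-1) ^ (i - 1)) (hecke_prod (hecke_T scale n) 0 (i - 1) f)"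
proof
  fix w
  have "hecke_prod (hecke_T scale n) 0 (i - 1) f
      = hecke_prod (hecke_T scale n) 0 (i - 1) (\<Sum>u\<in>words m n. tensor scale 0 (slice 0 u f) (basis_tensor u))"
    using tensor_expansion[of f m 0 n] assms(1) by simp
  also have "\<dots> = (\<Sum>u\<in>words m n. tensor scale 0 (slice 0 u f)
      (hecke_prod (hecke_T (*) n) 0 (i - 1) (basis_tensor u)))"
    using hecke_prod_tensor[of 0 n] by (simp add: H.HP.sum)
  finally have "hecke_prod (hecke_T scale n) 0 (i - 1) f w
      = (\<Sum>u\<in>words m n. scale (hecke_prod (hecke_T (*) n) 0 (i - 1) (basis_tensor u) w) (f u))"
    by (simp add: sum_fun_app tensor_def slice_def)
  moreover have "id_tensor_map scale m n (d_op m i) f w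
      = (\<Sum>u\<in>words m n. scale ((-1) ^ (i - 1) * hecke_prod (hecke_T (*) n) 0 (i - 1) (basis_tensor u) w) (f u))"
    unfolding id_tensor_map_def id_tensor_basis_def
    by (intro sum.cong) (simp_all add: d_op_eq_hecke_prod[OF basis_tensor_in assms(2)] pw_def)
  ultimately show "id_tensor_map scale m n (d_op m i) f w
      = pw scale ((-1) ^ (i - 1)) (hecke_prod (hecke_T scale n) 0 (i - 1) f) w"
    by (simp add: pw_def scale_sum_right)
qed

lemma YB_diff_eq:
  assumes "f \<in> tensor_space m n"
  shows "YB_diff m scale RM n f = act (\<sigma> n f)"
proof (cases n)
  case 0
  then show ?thesis by (simp add: YB_diff_def act_zero)
next
  case (Suc n')
  have hp: "hecke_prod (hecke_T scale n) 0 k f \<in> tensor_space m (Suc n')" for k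
    using hecke_prod_in_tensor_space[OF assms] Suc by simp
  have "YB_diff m scale RM n f = (\<Sum>i = 1..n. act (hecke_prod (hecke_T scale n) 0 (i - 1) f))"
    unfolding YB_diff_def face_def
  proof (intro sum.cong refl)
    fix i assume i: "i \<in> {1..n}"
    show "pw scale ((-1) ^ (i - 1)) (act (id_tensor_map scale m n (d_op m i) f))
        = act (hecke_prod (hecke_T scale n) 0 (i - 1) f)"
      unfolding id_tensor_map_d_op[OF assms i] act_scale[OF hp] by simp
  qed
  also have "\<dots> = (\<Sum>i<n. act (hecke_prod (hecke_T scale n) 0 i f))"
    by (rule sum.reindex_bij_witness[of _ Suc "\<lambda>k. k - 1"]) auto
  also have "\<dots> = act (\<sigma> n f)"
    by (simp add: hecke_sum_eq_sum H.T_add act_sum[OF hp])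
  finally show ?thesis .
qed

section \<open>The Yang-Baxter chain complex\<close>

lemma YB_diff_in_tensor_space:
  "f \<in> tensor_space m (Suc n) \<Longrightarrow> YB_diff m scale RM (Suc n) f \<in> tensor_space m n"
  by (simp add: YB_diff_eq act_in_tensor_space hecke_sum_in_tensor_space del: hecke_sum.simps)

lemma linear_on_YB_diff: "linear_on (pw scale) (pw scale) (tensor_space m n) (YB_diff m scale RM n)"
proof (cases n)
  case 0
  then show ?thesis
    by (simp add: linear_on_def YB_diff_def)
next
  case (Suc n')
  have sub: "P.subspace (tensor_space m n)"
    by (intro subspace_tensor_space vector_space_axioms)
  show ?thesis
    using P.subspace_add[OF sub] P.subspace_scale[OF sub] hecke_sum_in_tensor_space[of _ m n]
    unfolding linear_on_def Suc
    by (simp add: YB_diff_eq H.hecke_sum_linear act_add[of _ n'] act_scale[of _ n'] del: hecke_sum.simps)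
qed

lemma YB_diff_YB_diff:
  assumes "f \<in> tensor_space m (Suc n)"
  shows "YB_diff m scale RM n (YB_diff m scale RM (Suc n) f) = 0"
proof (cases n)
  case 0
  then show ?thesis by (simp add: YB_diff_def)
next
  case (Suc n')
  \<comment> \<open>Moving the second \<sigma> inside the first action shifts its operators by one;
    this gives the element \<open>Z f\<close> of the key identity.\<close>
  define z where "z = hecke_sum (hecke_T scale (Suc n)) (Suc 0) n (\<sigma> (Suc n) f)"
  have z: "z \<in> tensor_space m (Suc n)"
    unfolding z_def using assms by (intro hecke_sum_in_tensor_space)
  have "YB_diff m scale RM n (YB_diff m scale RM (Suc n) f) = act (act z)"
    using YB_diff_eq[OF assms] YB_diff_eq[OF YB_diff_in_tensor_space[OF assms]]
      act_hecke_sum[OF hecke_sum_in_tensor_space[OF assms], of 0 n]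
    by (simp add: z_def del: hecke_sum.simps)
  moreover have "act (act z) = 0"
  proof -
    have Tz: "hecke_T scale (Suc n) 0 z = pw scale qK z"
      unfolding z_def using H.hecke_sum_hecke_sum_eigenvector[of 0 n "Suc n" f] by simp
    \<comment> \<open>Before a double action, \<open>T 0\<close> can be replaced by \<open>q\<close>
      on \<open>z\<close> and by \<open>-1\<close> through the wall condition.\<close>
    have "pw scale qK (act (act z)) = act (act (pw scale qK z))"
      using z act_in_tensor_space[OF z] Suc by (simp add: act_scale)
    also have "\<dots> = - act (act z)"
      using act_act_hecke_T[of z n'] z Tz Suc by simp
    finally have "pw scale (qint qK 2) (act (act z)) = 0"
      by (simp add: qint_def numeral_2_eq_2 P.scale_left_distrib)
    then show ?thesis
      using qint_qK_nonzero[of 2] by (simp only: P.scale_eq_0_iff) simp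
  qed
  ultimately show ?thesis by simp
qed

lemma chain_complex_YB: "chain_complex (pw scale) (tensor_space m) (YB_diff m scale RM)"
  unfolding chain_complex_def
  by (simp add: linear_on_YB_diff subspace_tensor_space vector_space_axioms YB_diff_in_tensor_space
      YB_diff_YB_diff) (simp add: YB_diff_def)

lemma YB_diff_summand:
  assumes "f \<in> summand m scale k l"
  shows "YB_diff m scale RM (k + l) f = pw scale (qint qK k) (act f)"
proof -
  have f: "f \<in> tensor_space m (k + l)" "\<sigma> (k + l) f = pw scale (qint qK k) f"
    using summand_eq_eigenspace[of k "k + l" m] assms by auto
  show ?thesis
  proof (cases "k + l")
    case 0
    then show ?thesis by (simp add: YB_diff_def)
  next
    case (Suc n)
    then show ?thesis
      using f act_scale[of f n] YB_diff_eq[OF f(1)] by (simp del: hecke_sum.simps)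
  qed
qed

text \<open>Acting turns \<open>T (Suc i)\<close> into \<open>T i\<close>. So the eigenvalue
  conditions on \<open>f\<close> from \<open>T 1\<close> on become those on \<open>act f\<close>,
  and the kernel condition is shifted in the same way.\<close>

lemma act_in_summand:
  assumes "f \<in> summand m scale (Suc k) l"
  shows "act f \<in> summand m scale k l"
proof -
  have f: "f \<in> tensor_space m (Suc (k + l))" and inv: "H.q_invariant (Suc (k + l)) (Suc k) f"
    and ker: "hecke_sum (hecke_T scale (Suc (k + l))) (Suc k) l f = 0"
    using assms by (auto simp: summand_eq)
  have "hecke_T scale (k + l) i (act f) = pw scale qK (act f)" if "Suc i < k" for i
    using inv that act_hecke_T[OF f, of i] act_scale[OF f] by (simp add: H.q_invariant_def)
  then show ?thesis
    using act_in_tensor_space[OF f] act_hecke_sum[OF f, of k l] ker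
    by (simp add: summand_eq H.q_invariant_def act_zero)
qed

lemma YB_diff_in_summand:
  assumes "f \<in> summand m scale (Suc k) l"
  shows "YB_diff m scale RM (Suc (k + l)) f \<in> summand m scale k l"
  using YB_diff_summand[OF assms] act_in_summand[OF assms] P.subspace_scale[OF subspace_summand]
  by simp

text \<open>Since \<open>ker_sigma m 0\<close> is the ground field, results on summands specialize
  to the subcomplex.\<close>

lemma summand_0_right: "summand m scale k 0 = Cf m scale k"
  by (auto simp: summand_eq Cf_eq q_invariant_iff_alternating)

lemma YB_diff_Cf: "f \<in> Cf m scale k \<Longrightarrow> YB_diff m scale RM k f = pw scale (qint qK k) (act f)"
  using YB_diff_summand[of f k 0] by (simp add: summand_0_right)

lemma YB_diff_in_Cf: "f \<in> Cf m scale (Suc k) \<Longrightarrow> YB_diff m scale RM (Suc k) f \<in> Cf m scale k"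
  using YB_diff_in_summand[of f k 0] by (simp add: summand_0_right)

lemma Cf_subset: "Cf m scale n \<subseteq> tensor_space m n"
  by (auto simp: Cf_eq)

lemma subcomplex_Cf:
  "subcomplex (pw scale) (Cf m scale) (Cf_diff m scale RM) (tensor_space m) (YB_diff m scale RM)"
proof -
  have "linear_on (pw scale) (pw scale) (Cf m scale n) (Cf_diff m scale RM n)" for n
    using linear_on_YB_diff[of n] Cf_subset[of n] P.subspace_add[OF subspace_Cf]
      P.subspace_scale[OF subspace_Cf]
    by (simp add: linear_on_def Cf_diff_def subset_iff)
  moreover have "Cf_diff m scale RM n (Cf_diff m scale RM (Suc n) f) = 0" if "f \<in> Cf m scale (Suc n)" for n f
    using that YB_diff_YB_diff Cf_subset YB_diff_in_Cf[OF that] by (auto simp: Cf_diff_def)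
  moreover have "Cf_diff m scale RM 0 f = 0" if "f \<in> Cf m scale 0" for f
    using that by (simp add: Cf_diff_def YB_diff_def)
  ultimately show ?thesis
    unfolding subcomplex_def chain_complex_def
    using Cf_subset by (simp add: subspace_Cf YB_diff_in_Cf Cf_diff_def)
qed

text \<open>Both sides are \<open>[Suc k]\<close> times the action of the first factor. For the
  right side, slicing off the last factors and then the middle ones is the same as slicing
  once.\<close>

lemma YB_diff_eq_map_tensor_id:
  assumes "f \<in> summand m scale (Suc k) l"
  shows "YB_diff m scale RM (Suc (k + l)) f = map_tensor_id (Suc k) k (Cf_diff m scale RM (Suc k)) f"
proof
  fix w
  have f: "f \<in> tensor_space m (Suc k + l)" and "H.q_invariant (Suc k + l) (Suc k) f"
    using assms by (auto simp: summand_eq)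
  then have "alternating (Suc k + l) (Suc k) f"
    using q_invariant_iff_alternating[OF f, of "Suc k"] by simp
  then have Cf: "slice (Suc k) u f \<in> Cf m scale (Suc k)" for u
    by (rule slice_in_Cf[OF f])
  have "slice (Suc 0) (take k w) (slice (Suc k) (drop k w) f) = slice (Suc 0) w f"
  proof (cases "length w \<ge> k")
    case True
    then show ?thesis by (simp add: slice_def fun_eq_iff)
  next
    \<comment> \<open>For a word shorter than \<open>k\<close> the iterated slice is zero by its
      length test, and the single slice is zero because \<open>f\<close> is supported on words of
      length \<open>Suc k + l\<close>.\<close>
    case False
    then have "f (u @ w) = 0" if "length u = Suc 0" for u
      using that f by (auto simp: tensor_space_def words_def)
    then show ?thesis
      using False by (simp add: slice_def fun_eq_iff)
  qed
  then show "YB_diff m scale RM (Suc (k + l)) f w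
      = map_tensor_id (Suc k) k (Cf_diff m scale RM (Suc k)) f w"
    using YB_diff_summand[OF assms] YB_diff_Cf[OF Cf] Cf
    by (simp add: map_tensor_id_def Cf_diff_def pw_def act_apply)
qed

end

theorem theorem3p9:
  fixes m :: nat
    and scale :: "K \<Rightarrow> 'a::ab_group_add \<Rightarrow> 'a"
    and RM :: "(nat list \<Rightarrow> 'a) \<Rightarrow> 'a"
  assumes "m \<ge> 1"
    and "V_module m scale RM"
  shows "chain_complex (pw scale) (tensor_space m) (YB_diff m scale RM) \<and>
         subcomplex (pw scale) (Cf m scale) (Cf_diff m scale RM)
           (tensor_space m) (YB_diff m scale RM) \<and>
         (\<forall>n. module.subspace (pw (*)) (ker_sigma m n)) \<and>
         (\<forall>n. internal_direct_sum (pw scale) (tensor_space m n) {0..n}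
                (\<lambda>k. summand m scale k (n - k))) \<and>
         (\<forall>n. \<forall>k\<in>{1..n}. \<forall>f\<in>summand m scale k (n - k).
            YB_diff m scale RM n f \<in> summand m scale (k - 1) (n - k) \<and>
            YB_diff m scale RM n f = map_tensor_id k (k - 1) (Cf_diff m scale RM k) f) \<and>
         (\<forall>n. \<forall>f\<in>summand m scale 0 n. YB_diff m scale RM n f = 0)"
proof -
  interpret yang_baxter_module scale m RM
    using assms(2) by (simp add: yang_baxter_module_def yang_baxter_module_axioms_def
        tensor_module_def V_module_def)
  have "YB_diff m scale RM n f \<in> summand m scale (k - 1) (n - k) \<and>
      YB_diff m scale RM n f = map_tensor_id k (k - 1) (Cf_diff m scale RM k) f"
    if k: "k \<in> {1..n}" and f: "f \<in> summand m scale k (n - k)" for n k f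
  proof -
    obtain k' where k': "k = Suc k'"
      using k by (cases k) auto
    then have n: "n = Suc (k' + (n - k))"
      using k by simp
    show ?thesis
      using YB_diff_in_summand[of f k' "n - k"] YB_diff_eq_map_tensor_id[of f k' "n - k"] f n
      by (simp add: k')
  qed
  moreover have "YB_diff m scale RM n f = 0" if "f \<in> summand m scale 0 n" for n f
    using YB_diff_summand[OF that] by simp
  ultimately show ?thesis
    using chain_complex_YB subcomplex_Cf subspace_ker_sigma internal_direct_sum_summand by blast
qed

end
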